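(* Fix a natural number $g$. The tropical period map $$\mathcal P_g^{tr}:\mathcal T_g^{tr}\longrightarrow\Omega_g^{\rm rt},\qquad (C,h)\mapsto\phi_h^*(Q_C),$$ from the tropical Teichmüller space to the cone of rational positive semi-definite quadratic forms on $\mathbb R^g$, is a continuous map.
   Context: Graphs are finite and connected, loops and multiple edges allowed; $g(\Gamma)=|E(\Gamma)|-|V(\Gamma)|+1$; a loop counts twice in the valence. A weighted graph $(\Gamma,w)$ has $w:V(\Gamma)\to\mathbb Z_{\ge0}$; $|w|=\sum_vw(v)$; its genus is $g(\Gamma)+|w|$; it is stable if every vertex of weight $0$ has valence $\ge3$. A tropical curve of genus $g$ is $C=(\Gamma,w,l)$ with $(\Gamma,w)$ stable of genus $g$ and $l:E(\Gamma)\to\mathbb R_{>0}$. $\Gamma^w$ is obtained from $\Gamma$ by attaching $w(v)$ "virtual" loops at each vertex $v$. $R_g$ is the rose with one vertex $v$ and $g$ loops $\gamma_1,\dots,\gamma_g$. A marking of $(\Gamma,w)$ is a homotopy equivalence $h:R_g\to\Gamma^w$. Two markings $h,h'$ of $(\Gamma,w)$ are equivalent if, after homotoping $h$ and $h'$: (a) $h(v)=h'(v)$ is a point of $\Gamma$ which is not a vertex; (b) $h$ and $h'$ are immersions on the interior of each $\gamma_i$; (c) for each $i=1,\dots,g$, the directed loop $h'(\gamma_i)$ is obtained, up to homotopy fixing the basepoint, from the directed loop $h(\gamma_i)$ by repeatedly replacing sequences of virtual loops at a vertex with other sequences of virtual loops at that vertex (the sequences may be empty, i.e. virtual loops at a vertex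 may be added or removed). Marked weighted graphs $(\Gamma,w,h),(\Gamma',w',h')$ are equivalent if there is an isomorphism $\gamma:\Gamma^w\to\Gamma'^{w'}$ of 1-complexes taking virtual loops to virtual loops with $\gamma\circ h$ equivalent to $h'$; for marked tropical curves $(C,h)=(\Gamma,w,l,h)$ one also requires $\gamma$ to respect the lengths of the edges of $\Gamma$. Everything is up to equivalence. Specialization: $(\Gamma,w)\rightsquigarrow(\Gamma',w')$ if $\Gamma'$ arises by contracting a set $S$ of edges, where contracting a loop at a vertex increases the weight of that vertex by $1$ and contracting an edge between distinct $v_1,v_2$ gives a vertex of weight $w(v_1)+w(v_2)$. A marking $h$ of $(\Gamma,w)$ induces a marking $h'$ of $(\Gamma',w')$, well defined up to equivalence, by contracting a spanning forest of $S$ (the remaining edges of $S$ becoming virtual loops); then $(\Gamma,w,h)\rightsquigarrow(\Gamma',w',h')$. The inclusion $E(\Gamma')\hookrightarrow E(\Gamma)$ induces $L_\iota:\mathbb R_{\ge0}^{E(\Gamma')}\hookrightarrow\mathbb R_{\ge0}^{E(\Gamma)}$. $\mathcal T_g^{tr}$ is the topological quotient of $\coprod\mathbb R_{\ge0}^{E(\Gamma)}$, over equivalence classes of stable marked weighted graphs $(\Gamma,w,h)$ of genus $g$, by the equivalence relation generated by the maps $L_\iota$ of all specializations. Its points are the marked tropical curves of genus $g$: $(\Gamma,w,l,h)$ corresponds to $l\in\mathbb R_{>0}^{E(\Gamma)}$ in the cone of $(\Gamma,w,h)$. $\Omega_g^{\rm rt}$ is the set of positive semi-definite quadratic forms on $\mathbb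 R^g$ whose null space has a basis in $\mathbb Q^g$, with the topology induced from the space $\mathbb R^{\binom{g+1}2}$ of symmetric $g\times g$ matrices. For a tropical curve $C=(\Gamma,w,l)$, $Q_C$ is the quadratic form on $H_1(\Gamma,\mathbb R)\oplus\mathbb R^{|w|}$ that is zero on $\mathbb R^{|w|}$ and equals $Q_C(\sum_e\alpha_ee)=\sum_e\alpha_e^2l(e)$ on $H_1(\Gamma,\mathbb R)$. For a marking $h$, $\phi_h$ is the linear isomorphism $\mathbb R^g=H_1(R_g,\mathbb R)\xrightarrow{h_*}H_1(\Gamma^w,\mathbb R)\cong H_1(\Gamma,\mathbb R)\oplus\mathbb R^{|w|}$, the last isomorphism being induced by the map $\Gamma^w\to\Gamma$ contracting the virtual loops. *)

theory Defs
  imports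
    "HOL-Analysis.Analysis"
    "HOL-Homology.Homology"
    "Graph_Theory.Digraph_Component"
begin

section \<open>Graphs and their realizations as 1-complexes\<close>

text \<open>
  A graph with loops and multiple edges is a \<open>pre_digraph\<close>: its arcs are the edges, and the
  orientation given by \<open>tail\<close> and \<open>head\<close> is auxiliary (isomorphisms may reverse edges).
  A point of the realization is a vertex \<open>Inl v\<close> or a point \<open>Inr (e, t)\<close>, \<open>0 < t < 1\<close>, of an
  open edge.
\<close>

type_synonym ('v, 'e) point = "'v + 'e \<times> real"

definition edge_point :: "('v, 'e) pre_digraph \<Rightarrow> 'e \<Rightarrow> real \<Rightarrow> ('v, 'e) point" where
  "edge_point G e t = (if t \<le> 0 then Inl (tail G e) else if 1 \<le> t then Inl (head G e) else Inr (e, t))"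

definition points :: "('v, 'e) pre_digraph \<Rightarrow> ('v, 'e) point set" where
  "points G = Inl ` verts G \<union> Inr ` (arcs G \<times> {0<..<1})"

text \<open>
  The quotient topology of the disjoint union of the discrete space of vertices and one copy of
  \<open>[0, 1]\<close> for each edge.
\<close>

definition realization :: "('v, 'e) pre_digraph \<Rightarrow> ('v, 'e) point topology" where
  "realization G = topology (\<lambda>U. U \<subseteq> points G \<and>
     (\<forall>e\<in>arcs G. openin (top_of_set {0..1}) {t \<in> {0..1}. edge_point G e t \<in> U}))"

lemma openin_realization:
  "openin (realization G) U \<longleftrightarrow> U \<subseteq> points G \<and>
     (\<forall>e\<in>arcs G. openin (top_of_set {0..1}) {t \<in> {0..1}. edge_point G e t \<in> U})"
proof -
  have "istopology (\<lambda>U. U \<subseteq> points G \<and>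
     (\<forall>e\<in>arcs G. openin (top_of_set {0..1}) {t \<in> {0..1}. edge_point G e t \<in> U}))"
    unfolding istopology_def
  proof (intro conjI allI impI, goal_cases)
    case (1 S T)
    then show ?case by auto
  next
    case (2 S T)
    have "{t \<in> {0..1}. edge_point G e t \<in> S \<inter> T} =
        {t \<in> {0..1}. edge_point G e t \<in> S} \<inter> {t \<in> {0..1}. edge_point G e t \<in> T}" for e
      by auto
    with 2 show ?case by (auto intro: openin_Int)
  next
    case (3 \<K>)
    then show ?case by auto
  next
    case (4 \<K>)
    have "{t \<in> {0..1}. edge_point G e t \<in> \<Union>\<K>} = (\<Union>S\<in>\<K>. {t \<in> {0..1}. edge_point G e t \<in> S})" for e
      by auto
    with 4 show ?case by (auto intro!: openin_Union)
  qed
  then show ?thesis by (simp add: realization_def)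
qed

definition rose :: "nat \<Rightarrow> (unit, nat) pre_digraph" where
  "rose g = \<lparr>verts = {()}, arcs = {..<g}, tail = (\<lambda>_. ()), head = (\<lambda>_. ())\<rparr>"

abbreviation rose_vertex :: "(unit, nat) point" where
  "rose_vertex \<equiv> Inl ()"

definition homotopy_equivalence :: "'a topology \<Rightarrow> 'b topology \<Rightarrow> ('a \<Rightarrow> 'b) \<Rightarrow> bool" where
  "homotopy_equivalence X Y f \<longleftrightarrow> continuous_map X Y f \<and>
     (\<exists>f'. continuous_map Y X f' \<and>
        homotopic_with (\<lambda>_. True) X X (f' \<circ> f) id \<and>
        homotopic_with (\<lambda>_. True) Y Y (f \<circ> f') id)"


section \<open>Weighted graphs and tropical curves\<close>

type_synonym ('v, 'e) weighted_graph = "('v, 'e) pre_digraph \<times> ('v \<Rightarrow> nat)"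

definition valence :: "('v, 'e) pre_digraph \<Rightarrow> 'v \<Rightarrow> nat" where
  "valence G v = in_degree G v + out_degree G v"

definition genus :: "('v, 'e) weighted_graph \<Rightarrow> int" where
  "genus = (\<lambda>(G, w). int (card (arcs G)) - int (card (verts G)) + 1 + int (\<Sum>v\<in>verts G. w v))"

definition stable_graph :: "nat \<Rightarrow> ('v, 'e) weighted_graph \<Rightarrow> bool" where
  "stable_graph g = (\<lambda>(G, w). fin_digraph G \<and> Digraph_Component.connected G \<and>
     genus (G, w) = int g \<and> (\<forall>v\<in>verts G. w v = 0 \<longrightarrow> 3 \<le> valence G v))"

definition tropical_curve :: "nat \<Rightarrow> ('v, 'e) weighted_graph \<Rightarrow> ('e \<Rightarrow> real) \<Rightarrow> bool" where
  "tropical_curve g = (\<lambda>(G, w) l. stable_graph g (G, w) \<and> l \<in> arcs G \<rightarrow>\<^sub>E {0<..})"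

text \<open>The graph \<open>\<Gamma>\<^sup>w\<close>: \<open>Inl e\<close> is the edge \<open>e\<close>, and \<open>Inr (v, i)\<close> the \<open>i\<close>-th virtual loop at \<open>v\<close>.\<close>

definition virtual_loops :: "('v, 'e) weighted_graph \<Rightarrow> ('e + 'v \<times> nat) set" where
  "virtual_loops = (\<lambda>(G, w). Inr ` (SIGMA v:verts G. {..<w v}))"

definition virtual_graph :: "('v, 'e) weighted_graph \<Rightarrow> ('v, 'e + 'v \<times> nat) pre_digraph" where
  "virtual_graph = (\<lambda>(G, w). \<lparr>verts = verts G, arcs = Inl ` arcs G \<union> virtual_loops (G, w),
     tail = case_sum (tail G) fst, head = case_sum (head G) fst\<rparr>)"


section \<open>Markings\<close>

type_synonym ('v, 'e) marking = "(unit, nat) point \<Rightarrow> ('v, 'e + 'v \<times> nat) point"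

definition is_marking :: "nat \<Rightarrow> ('v, 'e) weighted_graph \<Rightarrow> ('v, 'e) marking \<Rightarrow> bool" where
  "is_marking g \<Gamma> h \<longleftrightarrow> homotopy_equivalence (realization (rose g)) (realization (virtual_graph \<Gamma>)) h"

definition path_concat :: "(real \<Rightarrow> 'a) \<Rightarrow> (real \<Rightarrow> 'a) \<Rightarrow> real \<Rightarrow> 'a" where
  "path_concat p q t = (if t \<le> 1/2 then p (2 * t) else q (2 * t - 1))"

definition path_from_to :: "'a topology \<Rightarrow> 'a \<Rightarrow> 'a \<Rightarrow> (real \<Rightarrow> 'a) \<Rightarrow> bool" where
  "path_from_to X x y p \<longleftrightarrow> pathin X p \<and> p 0 = x \<and> p 1 = y"

text \<open>
  The loop at \<open>v\<close> that traverses a sequence of virtual loops at \<open>v\<close>; a loop is traversed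
  backwards if its flag is \<open>True\<close>.
\<close>

fun virtual_sequence ::
  "('v, 'e) weighted_graph \<Rightarrow> 'v \<Rightarrow> (nat \<times> bool) list \<Rightarrow> real \<Rightarrow> ('v, 'e + 'v \<times> nat) point" where
  "virtual_sequence \<Gamma> v [] = (\<lambda>_. Inl v)"
| "virtual_sequence \<Gamma> v ((i, r) # is) =
     path_concat (\<lambda>t. edge_point (virtual_graph \<Gamma>) (Inr (v, i)) (if r then 1 - t else t))
       (virtual_sequence \<Gamma> v is)"

inductive virtual_step ::
  "('v, 'e) weighted_graph \<Rightarrow> ('v, 'e + 'v \<times> nat) point \<Rightarrow>
     (real \<Rightarrow> ('v, 'e + 'v \<times> nat) point) \<Rightarrow> (real \<Rightarrow> ('v, 'e + 'v \<times> nat) point) \<Rightarrow> bool"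
  for \<Gamma> :: "('v, 'e) weighted_graph" and b :: "('v, 'e + 'v \<times> nat) point" where
  homotopy: "homotopic_with (\<lambda>r. r 0 = b \<and> r 1 = b) (top_of_set {0..1}) (realization (virtual_graph \<Gamma>)) p q
    \<Longrightarrow> virtual_step \<Gamma> b p q"
| replace: "\<lbrakk>v \<in> verts (fst \<Gamma>);
    path_from_to (realization (virtual_graph \<Gamma>)) b (Inl v) p;
    path_from_to (realization (virtual_graph \<Gamma>)) (Inl v) b q;
    fst ` set is \<subseteq> {..<snd \<Gamma> v}; fst ` set js \<subseteq> {..<snd \<Gamma> v}\<rbrakk>
    \<Longrightarrow> virtual_step \<Gamma> b
          (path_concat p (path_concat (virtual_sequence \<Gamma> v is) q))
          (path_concat p (path_concat (virtual_sequence \<Gamma> v js) q))"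

text \<open>
  If \<open>\<Gamma>\<close> has no edges, then every point of \<open>\<Gamma>\<close> is a vertex, and the basepoint is
  the vertex of \<open>\<Gamma>\<close>.
\<close>

definition admissible_basepoint :: "('v, 'e) pre_digraph \<Rightarrow> ('v, 'e + 'v \<times> nat) point \<Rightarrow> bool" where
  "admissible_basepoint G b \<longleftrightarrow>
     (\<exists>e\<in>arcs G. \<exists>t\<in>{0<..<1}. b = Inr (Inl e, t)) \<or> (arcs G = {} \<and> b \<in> Inl ` verts G)"

definition marked_loop :: "nat \<Rightarrow> ((unit, nat) point \<Rightarrow> 'a) \<Rightarrow> nat \<Rightarrow> real \<Rightarrow> 'a" where
  "marked_loop g h i t = h (edge_point (rose g) i t)"

definition immersed_on_interior :: "(real \<Rightarrow> 'a) \<Rightarrow> bool" where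
  "immersed_on_interior p \<longleftrightarrow>
     (\<forall>t\<in>{0<..<1}. \<exists>\<epsilon>>0. inj_on p ({t - \<epsilon> <..< t + \<epsilon>} \<inter> {0<..<1}))"

definition marking_equiv ::
  "nat \<Rightarrow> ('v, 'e) weighted_graph \<Rightarrow> ('v, 'e) marking \<Rightarrow> ('v, 'e) marking \<Rightarrow> bool" where
  "marking_equiv g \<Gamma> h h' \<longleftrightarrow> (\<exists>k k'.
     homotopic_with (\<lambda>_. True) (realization (rose g)) (realization (virtual_graph \<Gamma>)) h k \<and>
     homotopic_with (\<lambda>_. True) (realization (rose g)) (realization (virtual_graph \<Gamma>)) h' k' \<and>
     k rose_vertex = k' rose_vertex \<and> admissible_basepoint (fst \<Gamma>) (k rose_vertex) \<and>
     (\<forall>i<g. immersed_on_interior (marked_loop g k i) \<and> immersed_on_interior (marked_loop g k' i)) \<and>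
     (\<forall>i<g. (virtual_step \<Gamma> (k rose_vertex))\<^sup>*\<^sup>* (marked_loop g k i) (marked_loop g k' i)))"


section \<open>Isomorphisms and specializations of marked weighted graphs\<close>

text \<open>
  An isomorphism \<open>\<Gamma>\<^sup>w \<rightarrow> \<Gamma>'\<^sup>w\<close> of 1-complexes that takes virtual loops to virtual loops, given by
  bijections \<open>a\<close> on vertices and \<open>b\<close> on edges; \<open>\<sigma> e\<close> says that \<open>e\<close> is mapped to
  \<open>b e\<close> with the orientation reversed (for a loop this is additional information).
\<close>

definition graph_isomorphism ::
  "('v, 'e) weighted_graph \<Rightarrow> ('v, 'e) weighted_graph \<Rightarrow>
     ('v \<Rightarrow> 'v) \<Rightarrow> ('e + 'v \<times> nat \<Rightarrow> 'e + 'v \<times> nat) \<Rightarrow> ('e + 'v \<times> nat \<Rightarrow> bool) \<Rightarrow> bool" where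
  "graph_isomorphism \<Gamma> \<Gamma>' a b \<sigma> \<longleftrightarrow>
     bij_betw a (verts (fst \<Gamma>)) (verts (fst \<Gamma>')) \<and>
     bij_betw b (Inl ` arcs (fst \<Gamma>)) (Inl ` arcs (fst \<Gamma>')) \<and>
     bij_betw b (virtual_loops \<Gamma>) (virtual_loops \<Gamma>') \<and>
     (\<forall>e\<in>arcs (virtual_graph \<Gamma>).
        (tail (virtual_graph \<Gamma>') (b e), head (virtual_graph \<Gamma>') (b e)) =
        (if \<sigma> e then (a (head (virtual_graph \<Gamma>) e), a (tail (virtual_graph \<Gamma>) e))
         else (a (tail (virtual_graph \<Gamma>) e), a (head (virtual_graph \<Gamma>) e))))"

fun isomorphism_map ::
  "('v \<Rightarrow> 'v) \<Rightarrow> ('e \<Rightarrow> 'e) \<Rightarrow> ('e \<Rightarrow> bool) \<Rightarrow> ('v, 'e) point \<Rightarrow> ('v, 'e) point" where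
  "isomorphism_map a b \<sigma> (Inl v) = Inl (a v)"
| "isomorphism_map a b \<sigma> (Inr (e, t)) = Inr (b e, if \<sigma> e then 1 - t else t)"

definition connected_via :: "('v, 'e) pre_digraph \<Rightarrow> 'e set \<Rightarrow> 'v \<Rightarrow> 'v \<Rightarrow> bool" where
  "connected_via G S u v \<longleftrightarrow> u \<rightarrow>\<^sup>*\<^bsub>with_proj (mk_symmetric (G\<lparr>arcs := S\<rparr>))\<^esub> v"

text \<open>The graph with all vertices of \<open>G\<close> and edges \<open>F\<close> has no cycle iff every edge is a bridge.\<close>

definition spanning_forest :: "('v, 'e) pre_digraph \<Rightarrow> 'e set \<Rightarrow> 'e set \<Rightarrow> bool" where
  "spanning_forest G S F \<longleftrightarrow> F \<subseteq> S \<and> connected_via G F = connected_via G S \<and>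
     (\<forall>e\<in>F. \<not> connected_via G (F - {e}) (tail G e) (head G e))"

text \<open>
  \<open>contraction \<Gamma> S F c \<beta> \<Gamma>'\<close>: \<open>\<Gamma>'\<close> is obtained by contracting the edges in \<open>S\<close>. First the
  edges of the spanning forest \<open>F\<close> of \<open>S\<close> are contracted, which adds up the weights of the
  identified vertices; \<open>c\<close> is the resulting map on vertices. Each edge in \<open>S - F\<close> has then become
  a loop, and contracting it increases the weight of its vertex by \<open>1\<close>. The bijection \<open>\<beta>\<close>
  identifies these loops and the virtual loops of \<open>\<Gamma>\<close> with the virtual loops of \<open>\<Gamma>'\<close>.
\<close>

definition contraction ::
  "('v, 'e) weighted_graph \<Rightarrow> 'e set \<Rightarrow> 'e set \<Rightarrow> ('v \<Rightarrow> 'v) \<Rightarrow>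
     ('e + 'v \<times> nat \<Rightarrow> 'e + 'v \<times> nat) \<Rightarrow> ('v, 'e) weighted_graph \<Rightarrow> bool" where
  "contraction = (\<lambda>(G, w) S F c \<beta> (G', w').
     S \<subseteq> arcs G \<and> spanning_forest G S F \<and>
     c ` verts G = verts G' \<and>
     (\<forall>u\<in>verts G. \<forall>v\<in>verts G. c u = c v \<longleftrightarrow> connected_via G S u v) \<and>
     arcs G' = arcs G - S \<and>
     (\<forall>e\<in>arcs G'. tail G' e = c (tail G e) \<and> head G' e = c (head G e)) \<and>
     (\<forall>v'\<in>verts G'. w' v' = (\<Sum>v\<in>{v \<in> verts G. c v = v'}. w v) + card {e \<in> S - F. c (tail G e) = v'}) \<and>
     bij_betw \<beta> (Inl ` (S - F) \<union> virtual_loops (G, w)) (virtual_loops (G', w')) \<and>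
     (\<forall>e\<in>Inl ` (S - F) \<union> virtual_loops (G, w).
        tail (virtual_graph (G', w')) (\<beta> e) = c (tail (virtual_graph (G, w)) e)))"

fun contraction_map ::
  "('v, 'e) weighted_graph \<Rightarrow> 'e set \<Rightarrow> 'e set \<Rightarrow> ('v \<Rightarrow> 'v) \<Rightarrow>
     ('e + 'v \<times> nat \<Rightarrow> 'e + 'v \<times> nat) \<Rightarrow> ('v, 'e + 'v \<times> nat) point \<Rightarrow> ('v, 'e + 'v \<times> nat) point" where
  "contraction_map \<Gamma> S F c \<beta> (Inl v) = Inl (c v)"
| "contraction_map \<Gamma> S F c \<beta> (Inr (e, t)) =
     (if e \<in> Inl ` F then Inl (c (tail (virtual_graph \<Gamma>) e))
      else if e \<in> Inl ` (S - F) \<union> virtual_loops \<Gamma> then Inr (\<beta> e, t)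
      else Inr (e, t))"

type_synonym ('v, 'e) marked_graph = "('v, 'e) weighted_graph \<times> ('v, 'e) marking"

definition marked_isomorphism ::
  "nat \<Rightarrow> ('v, 'e) marked_graph \<Rightarrow> ('v, 'e) marked_graph \<Rightarrow> ('e + 'v \<times> nat \<Rightarrow> 'e + 'v \<times> nat) \<Rightarrow> bool" where
  "marked_isomorphism g = (\<lambda>(\<Gamma>, h) (\<Gamma>', h') b. \<exists>a \<sigma>.
     graph_isomorphism \<Gamma> \<Gamma>' a b \<sigma> \<and> marking_equiv g \<Gamma>' (isomorphism_map a b \<sigma> \<circ> h) h')"

text \<open>
  \<open>(\<Gamma>, w, h)\<close> specializes to \<open>(\<Gamma>', w', h')\<close> up to equivalence of marked weighted graphs;
  \<open>\<iota>\<close> is the inclusion of \<open>E(\<Gamma>')\<close> into \<open>E(\<Gamma>)\<close>. For \<open>S = {}\<close> this includes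
  equivalence of marked weighted graphs.
\<close>

definition marked_specialization ::
  "nat \<Rightarrow> ('v, 'e) marked_graph \<Rightarrow> ('v, 'e) marked_graph \<Rightarrow> ('e \<Rightarrow> 'e) \<Rightarrow> bool" where
  "marked_specialization g = (\<lambda>(\<Gamma>, h) (\<Gamma>', h') \<iota>. \<exists>S F c \<beta> \<Gamma>'' b.
     contraction \<Gamma> S F c \<beta> \<Gamma>'' \<and>
     marked_isomorphism g (\<Gamma>'', contraction_map \<Gamma> S F c \<beta> \<circ> h) (\<Gamma>', h') b \<and>
     (\<forall>e\<in>arcs (fst \<Gamma>'). \<iota> e \<in> arcs (fst \<Gamma>'') \<and> b (Inl (\<iota> e)) = Inl e))"


section \<open>Tropical Teichmueller space\<close>

text \<open>
  Every finite graph is isomorphic to one whose vertices and edges are natural numbers.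
\<close>

type_synonym mgraph = "(nat, nat) marked_graph"

definition marked_graphs :: "nat \<Rightarrow> mgraph set" where
  "marked_graphs g = {(\<Gamma>, h). stable_graph g \<Gamma> \<and> is_marking g \<Gamma> h}"

definition cone :: "mgraph \<Rightarrow> (nat \<Rightarrow> real) topology" where
  "cone m = product_topology (\<lambda>_. top_of_set {0..}) (arcs (fst (fst m)))"

text \<open>The map \<open>L\<^sub>\<iota>\<close> from the cone of \<open>m'\<close> to the cone of \<open>m\<close>, for \<open>\<iota>\<close> injective on the edges of \<open>m'\<close>.\<close>

definition cone_inclusion :: "mgraph \<Rightarrow> mgraph \<Rightarrow> (nat \<Rightarrow> nat) \<Rightarrow> (nat \<Rightarrow> real) \<Rightarrow> nat \<Rightarrow> real" where
  "cone_inclusion m m' \<iota> l' = (let E = arcs (fst (fst m)); E' = arcs (fst (fst m'))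
     in (\<lambda>e\<in>E. if e \<in> \<iota> ` E' then l' (the_inv_into E' \<iota> e) else 0))"

definition cone_coproduct :: "nat \<Rightarrow> (mgraph \<times> (nat \<Rightarrow> real)) topology" where
  "cone_coproduct g = sum_topology cone (marked_graphs g)"

text \<open>
  The coproduct has one cone for every marked graph instead of one for every equivalence class;
  since \<open>marked_specialization\<close> includes equivalences, cones of equivalent marked graphs
  are identified, and the quotient space is the same.
\<close>

definition cone_gluing :: "nat \<Rightarrow> ((mgraph \<times> (nat \<Rightarrow> real)) \<times> (mgraph \<times> (nat \<Rightarrow> real))) set" where
  "cone_gluing g = {((m', l'), (m, cone_inclusion m m' \<iota> l')) | m m' \<iota> l'.
     m \<in> marked_graphs g \<and> m' \<in> marked_graphs g \<and> marked_specialization g m m' \<iota> \<and>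
     l' \<in> topspace (cone m')}"

definition generated_equiv :: "'a set \<Rightarrow> ('a \<times> 'a) set \<Rightarrow> ('a \<times> 'a) set" where
  "generated_equiv A r = \<Inter>{R. equiv A R \<and> r \<subseteq> R}"

definition quotient_space :: "'a topology \<Rightarrow> ('a \<times> 'a) set \<Rightarrow> 'a set topology" where
  "quotient_space X R = topology (\<lambda>U. U \<subseteq> topspace X // R \<and> openin X {x \<in> topspace X. R `` {x} \<in> U})"

lemma openin_quotient_space:
  "openin (quotient_space X R) U \<longleftrightarrow>
     U \<subseteq> topspace X // R \<and> openin X {x \<in> topspace X. R `` {x} \<in> U}"
proof -
  have "istopology (\<lambda>U. U \<subseteq> topspace X // R \<and> openin X {x \<in> topspace X. R `` {x} \<in> U})"
    unfolding istopology_def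
  proof (intro conjI allI impI, goal_cases)
    case (1 S T)
    then show ?case by auto
  next
    case (2 S T)
    have "{x \<in> topspace X. R `` {x} \<in> S \<inter> T} =
        {x \<in> topspace X. R `` {x} \<in> S} \<inter> {x \<in> topspace X. R `` {x} \<in> T}"
      by auto
    with 2 show ?case by (auto intro: openin_Int)
  next
    case (3 \<K>)
    then show ?case by auto
  next
    case (4 \<K>)
    have "{x \<in> topspace X. R `` {x} \<in> \<Union>\<K>} = (\<Union>S\<in>\<K>. {x \<in> topspace X. R `` {x} \<in> S})"
      by auto
    with 4 show ?case by (auto intro!: openin_Union)
  qed
  then show ?thesis by (simp add: quotient_space_def)
qed

definition teich_equiv :: "nat \<Rightarrow> ((mgraph \<times> (nat \<Rightarrow> real)) \<times> (mgraph \<times> (nat \<Rightarrow> real))) set" where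
  "teich_equiv g = generated_equiv (topspace (cone_coproduct g)) (cone_gluing g)"

definition tropical_teichmueller_space :: "nat \<Rightarrow> (mgraph \<times> (nat \<Rightarrow> real)) set topology" where
  "tropical_teichmueller_space g = quotient_space (cone_coproduct g) (teich_equiv g)"

definition teich_point :: "nat \<Rightarrow> mgraph \<Rightarrow> (nat \<Rightarrow> real) \<Rightarrow> (mgraph \<times> (nat \<Rightarrow> real)) set" where
  "teich_point g m l = teich_equiv g `` {(m, l)}"


section \<open>Rational positive semi-definite quadratic forms\<close>

text \<open>\<open>\<real>\<^sup>g\<close> is \<open>topspace (Euclidean_space g)\<close>, the set of \<open>x\<close> with \<open>x i = 0\<close> for \<open>i \<ge> g\<close>.\<close>

abbreviation real_space :: "nat \<Rightarrow> (nat \<Rightarrow> real) set" where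
  "real_space g \<equiv> topspace (Euclidean_space g)"

definition unit_vec :: "nat \<Rightarrow> nat \<Rightarrow> real" where
  "unit_vec i = (\<lambda>k. if k = i then 1 else 0)"

definition quadratic_form :: "nat \<Rightarrow> ((nat \<Rightarrow> real) \<Rightarrow> real) \<Rightarrow> bool" where
  "quadratic_form g q \<longleftrightarrow> q \<in> extensional (real_space g) \<and>
     (\<exists>A. (\<forall>i j. A i j = A j i) \<and>
        (\<forall>x\<in>real_space g. q x = (\<Sum>i<g. \<Sum>j<g. A i j * x i * x j)))"

definition polar_form :: "((nat \<Rightarrow> real) \<Rightarrow> real) \<Rightarrow> (nat \<Rightarrow> real) \<Rightarrow> (nat \<Rightarrow> real) \<Rightarrow> real" where
  "polar_form q x y = (q (\<lambda>i. x i + y i) - q x - q y) / 2"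

definition null_space :: "nat \<Rightarrow> ((nat \<Rightarrow> real) \<Rightarrow> real) \<Rightarrow> (nat \<Rightarrow> real) set" where
  "null_space g q = {x \<in> real_space g. \<forall>y\<in>real_space g. polar_form q x y = 0}"

definition has_rational_basis :: "(nat \<Rightarrow> real) set \<Rightarrow> bool" where
  "has_rational_basis N \<longleftrightarrow> (\<exists>k b. (\<forall>j<k. b j \<in> N \<and> (\<forall>i. b j i \<in> \<rat>)) \<and>
     (\<forall>x\<in>N. \<exists>!c. c \<in> {..<k::nat} \<rightarrow>\<^sub>E UNIV \<and> x = (\<lambda>i. \<Sum>j<k. c j * b j i)))"

definition rational_psd_forms :: "nat \<Rightarrow> ((nat \<Rightarrow> real) \<Rightarrow> real) set" where
  "rational_psd_forms g = {q. quadratic_form g q \<and> (\<forall>x\<in>real_space g. 0 \<le> q x) \<and>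
     has_rational_basis (null_space g q)}"

definition gram_matrix :: "nat \<Rightarrow> ((nat \<Rightarrow> real) \<Rightarrow> real) \<Rightarrow> nat \<times> nat \<Rightarrow> real" where
  "gram_matrix g q = (\<lambda>(i, j)\<in>{(i, j). i \<le> j \<and> j < g}. polar_form q (unit_vec i) (unit_vec j))"

text \<open>
  A symmetric matrix is given by its entries on and above the diagonal.
\<close>

definition Omega_rt :: "nat \<Rightarrow> ((nat \<Rightarrow> real) \<Rightarrow> real) topology" where
  "Omega_rt g = pullback_topology (rational_psd_forms g) (gram_matrix g)
     (product_topology (\<lambda>_. euclideanreal) {(i, j). i \<le> j \<and> j < g})"


section \<open>The tropical period map\<close>

text \<open>
  First homology with coefficients in \<open>\<real>\<close> is integral homology tensored with \<open>\<real>\<close>. The circle is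
  the rose with one petal. The choice of generator of its first homology is immaterial, because
  the generator enters both the class \<open>\<gamma>\<^sub>i\<close> and the coefficients of homology classes below.
\<close>

abbreviation circle :: "(unit, nat) point topology" where
  "circle \<equiv> realization (rose 1)"

definition circle_class :: "(unit, nat) point chain set" where
  "circle_class = (SOME u. u \<in> carrier (homology_group 1 circle) \<and>
     subgroup_generated (homology_group 1 circle) {u} = homology_group 1 circle)"

fun petal :: "nat \<Rightarrow> (unit, nat) point \<Rightarrow> (unit, nat) point" where
  "petal i (Inl _) = rose_vertex"
| "petal i (Inr (_, t)) = Inr (i, t)"

definition petal_class :: "nat \<Rightarrow> nat \<Rightarrow> (unit, nat) point chain set" where
  "petal_class g i = hom_induced 1 circle {} (realization (rose g)) {} (petal i) circle_class"

text \<open>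
  The coefficient \<open>\<alpha>\<^sub>e\<close> of a homology class \<open>\<Sum>\<^sub>e \<alpha>\<^sub>e e\<close> of a graph: its image in the first homology
  of the circle obtained by collapsing the complement of the open edge \<open>e\<close> to a point.
\<close>

fun collapse :: "'e \<Rightarrow> ('v, 'e) point \<Rightarrow> (unit, nat) point" where
  "collapse e (Inl _) = rose_vertex"
| "collapse e (Inr (e', t)) = (if e' = e then Inr (0, t) else rose_vertex)"

definition edge_coefficient :: "('v, 'e) pre_digraph \<Rightarrow> ('v, 'e) point chain set \<Rightarrow> 'e \<Rightarrow> int" where
  "edge_coefficient G \<zeta> e = (THE k::int.
     hom_induced 1 (realization G) {} circle {} (collapse e) \<zeta> =
     circle_class [^]\<^bsub>homology_group 1 circle\<^esub> k)"

text \<open>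
  An element of \<open>H\<^sub>1(\<Gamma>, \<real>) \<oplus> \<real>\<^sup>|\<^sup>w\<^sup>|\<close> is given by its coefficients at the edges of \<open>\<Gamma>\<close> and
  at the virtual loops; the map contracting the virtual loops forgets the latter. The quadratic form
  is given by the same formula on all 1-chains, of which only the cycles are in the image of \<open>\<phi>\<^sub>h\<close>.
\<close>

definition phi ::
  "nat \<Rightarrow> ('v, 'e) weighted_graph \<Rightarrow> ('v, 'e) marking \<Rightarrow> (nat \<Rightarrow> real) \<Rightarrow> ('e \<Rightarrow> real) \<times> ('v \<times> nat \<Rightarrow> real)" where
  "phi g \<Gamma> h x =
     (let h_star = hom_induced 1 (realization (rose g)) {} (realization (virtual_graph \<Gamma>)) {} h;
          \<alpha> = (\<lambda>e. \<Sum>i<g. x i * of_int (edge_coefficient (virtual_graph \<Gamma>) (h_star (petal_class g i)) e))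
      in (\<lambda>e. \<alpha> (Inl e), \<lambda>a. \<alpha> (Inr a)))"

definition curve_form ::
  "('v, 'e) weighted_graph \<Rightarrow> ('e \<Rightarrow> real) \<Rightarrow> ('e \<Rightarrow> real) \<times> ('v \<times> nat \<Rightarrow> real) \<Rightarrow> real" where
  "curve_form \<Gamma> l = (\<lambda>(\<alpha>, _). \<Sum>e\<in>arcs (fst \<Gamma>). (\<alpha> e)\<^sup>2 * l e)"

definition pullback_form ::
  "nat \<Rightarrow> ('v, 'e) weighted_graph \<Rightarrow> ('v, 'e) marking \<Rightarrow> ('e \<Rightarrow> real) \<Rightarrow> (nat \<Rightarrow> real) \<Rightarrow> real" where
  "pullback_form g \<Gamma> h l = (\<lambda>x\<in>real_space g. curve_form \<Gamma> l (phi g \<Gamma> h x))"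

text \<open>
  The common value of \<open>\<phi>\<^sub>h\<^sup>*(Q\<^sub>C)\<close> on all representatives \<open>(\<Gamma>, w, h, l)\<close> of a point. These
  include the marked tropical curves representing the point, but also elements of the boundaries of
  cones, where \<open>l\<close> vanishes on some edges and \<open>Q\<^sub>C\<close> is given by the same formula.
\<close>

definition tropical_period_map ::
  "nat \<Rightarrow> (mgraph \<times> (nat \<Rightarrow> real)) set \<Rightarrow> (nat \<Rightarrow> real) \<Rightarrow> real" where
  "tropical_period_map g p = the_elem ((\<lambda>((\<Gamma>, h), l). pullback_form g \<Gamma> h l) ` p)"

end

(*
  The coefficient of h_*(gamma_i) at an edge e of Gamma is the winding number of the loop obtained
  from h(gamma_i) by collapsing the complement of the open edge e to a point. Collapsing makes every
  sequence of virtual loops constant, so the moves defining equivalence of markings do not change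
  the coefficients at edges of Gamma. It also commutes with contracting the other edges, and with
  isomorphisms up to a reflection of the circle, which changes all coefficients at e by a common
  sign. The pulled back form is sum_e l(e) (sum_i x_i c_ie)^2, hence compatible with
  specializations; it is linear in l on each cone, hence continuous; and its null space is the
  kernel of the integer matrix with the rows (c_ie)_i for l(e) > 0, hence rational.
*)

theory Submission
  imports Defs
begin

declare One_nat_def [simp del]

section \<open>Realizations as quotient spaces\<close>

lemma points_edge_point:
  assumes "wf_digraph G" "e \<in> arcs G" "t \<in> {0..1}"
  shows "edge_point G e t \<in> points G"
  using assms by (auto simp: edge_point_def points_def wf_digraph_def)

text \<open>Well-formedness puts the ends of every edge among the vertices, so
  \<open>points G\<close> satisfies its own openness condition and is the largest open set.\<close>

lemma topspace_realization:
  assumes "wf_digraph G"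
  shows "topspace (realization G) = points G"
proof -
  have "{t \<in> {0..1}. edge_point G e t \<in> points G} = {0..1}" if "e \<in> arcs G" for e
    using points_edge_point[OF assms that] by auto
  then have "openin (realization G) (points G)"
    by (auto simp: openin_realization)
  then show ?thesis
    using openin_realization[of G "topspace (realization G)"] by (simp add: openin_subset subset_antisym)
qed

text \<open>The universal property of the quotient topology. The vertices form a discrete space, so
  continuity has to be tested on the edges only.\<close>

lemma continuous_map_from_realization:
  assumes "wf_digraph G" "f \<in> points G \<rightarrow> topspace Y"
    "\<And>e. e \<in> arcs G \<Longrightarrow> continuous_map (top_of_set {0..1}) Y (\<lambda>t. f (edge_point G e t))"
  shows "continuous_map (realization G) Y f"
  unfolding continuous_map_def topspace_realization[OF assms(1)]
proof (intro conjI allI impI)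
  fix U assume U: "openin Y U"
  have "openin (top_of_set {0..1}) {t \<in> {0..1}. edge_point G e t \<in> {x \<in> points G. f x \<in> U}}"
    if "e \<in> arcs G" for e
  proof -
    have "{t \<in> {0..1}. edge_point G e t \<in> {x \<in> points G. f x \<in> U}} =
        {t \<in> topspace (top_of_set {0..1}). f (edge_point G e t) \<in> U}"
      using points_edge_point[OF assms(1) that] by auto
    then show ?thesis
      using openin_continuous_map_preimage[OF assms(3)[OF that] U] by simp
  qed
  then show "openin (realization G) {x \<in> points G. f x \<in> U}"
    by (auto simp: openin_realization)
qed (use assms in auto)

lemma continuous_map_edge_point:
  assumes "wf_digraph G" "e \<in> arcs G"
  shows "continuous_map (top_of_set {0..1}) (realization G) (edge_point G e)"
  unfolding continuous_map_def topspace_realization[OF assms(1)]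
  using assms points_edge_point[OF assms] by (auto simp: openin_realization)

lemma wf_digraph_rose: "wf_digraph (rose g)"
  by (auto simp: rose_def wf_digraph_def)

lemma arcs_rose: "arcs (rose g) = {..<g}"
  by (simp add: rose_def)

lemma points_circle: "points (rose 1) = insert rose_vertex (Inr ` ({0} \<times> {0<..<1}))"
  by (auto simp: points_def rose_def)

lemma points_circle_cases:
  assumes "x \<in> points (rose 1)"
  obtains "x = rose_vertex" | t where "x = Inr (0, t)" "0 < t" "t < 1"
  using assms by (auto simp: points_circle)

lemma edge_point_circle:
  "edge_point (rose 1) 0 t = (if 0 < t \<and> t < 1 then Inr (0, t) else rose_vertex)"
  by (auto simp: edge_point_def rose_def)

text \<open>The single edge covers the whole rose with one petal, so the realization topology is
  that of the unit interval with its ends identified. Continuity of maps out of the circle is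
  checked on the interval through this fact.\<close>

lemma quotient_map_circle: "quotient_map (top_of_set {0..1}) circle (edge_point (rose 1) 0)"
proof -
  have "edge_point (rose 1) 0 ` {0..1} = points (rose 1)"
  proof (intro subset_antisym subsetI)
    fix x assume "x \<in> points (rose 1)"
    then show "x \<in> edge_point (rose 1) 0 ` {0..1}"
    proof (cases rule: points_circle_cases)
      case 1
      then show ?thesis by (intro image_eqI[of _ _ 0]) (auto simp: edge_point_circle)
    next
      case (2 t)
      then show ?thesis by (intro image_eqI[of _ _ t]) (auto simp: edge_point_circle)
    qed
  qed (auto simp: points_edge_point wf_digraph_rose arcs_rose)
  moreover have "arcs (rose 1) = {0}"
    by (auto simp: rose_def)
  ultimately show ?thesis
    by (auto simp: quotient_map_def topspace_realization wf_digraph_rose openin_realization)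
qed

section \<open>Loops\<close>

text \<open>This is only meaningful if \<open>p 0 = p 1\<close>.\<close>

fun loop_map :: "(real \<Rightarrow> 'a) \<Rightarrow> (unit, nat) point \<Rightarrow> 'a" where
  "loop_map p (Inl _) = p 0"
| "loop_map p (Inr (_, t)) = p t"

text \<open>A homotopy of based loops takes the value \<open>b\<close> on both vertical sides of the
  square, hence factors through the product of the interval and the circle.\<close>

lemma homotopic_loop_maps:
  assumes "homotopic_with (\<lambda>r. r 0 = b \<and> r 1 = b) (top_of_set {0..1}) X p q"
  shows "homotopic_with (\<lambda>_. True) circle X (loop_map p) (loop_map q)"
proof -
  let ?I = "top_of_set {0..1::real}"
  obtain H where H: "continuous_map (prod_topology ?I ?I) X H"
      "\<And>s. H (0, s) = p s" "\<And>s. H (1, s) = q s"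
    and b: "\<And>t. t \<in> {0..1} \<Longrightarrow> H (t, 0) = b \<and> H (t, 1) = b"
    using assms unfolding homotopic_with_def by auto
  let ?K = "\<lambda>(t, x). loop_map (\<lambda>s. H (t, s)) x"
  let ?\<pi> = "\<lambda>(t, s). (t, edge_point (rose 1) 0 s)"
  \<comment> \<open>The product of a quotient map with the identity of a locally compact Hausdorff
    space is again a quotient map, so continuity of \<open>?K\<close> can be tested on the
    square.\<close>
  have "quotient_map (prod_topology ?I ?I) (prod_topology ?I circle) ?\<pi>"
  proof (rule quotient_map_prod_right[OF _ _ quotient_map_circle])
    show "locally_compact_space ?I"
      by (rule compact_imp_locally_compact_space) (simp add: compact_space_subtopology)
  qed (simp add: Hausdorff_space_subtopology)
  \<comment> \<open>The composite is \<open>H\<close> itself: at \<open>s = 1\<close> it takes the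
    value of \<open>H\<close> at \<open>s = 0\<close>, and both are \<open>b\<close>.\<close>
  moreover have "continuous_map (prod_topology ?I ?I) X (?K \<circ> ?\<pi>)"
    by (rule continuous_map_eq[OF H(1)]) (auto simp: edge_point_circle b not_less)
  ultimately have "continuous_map (prod_topology ?I circle) X ?K"
    using continuous_compose_quotient_map_eq by blast
  moreover have "?K (0, x) = loop_map p x" "?K (1, x) = loop_map q x" for x
    using H by auto
  ultimately show ?thesis
    unfolding homotopic_with_def by (intro exI[of _ ?K]) simp
qed

section \<open>The first homology group of the circle\<close>

text \<open>The parametrization with period 1 of \<open>nsphere 1\<close>, whose points are
  sequences supported on the coordinates 0 and 1.\<close>

definition sphere_point :: "real \<Rightarrow> nat \<Rightarrow> real" where
  "sphere_point t = (\<lambda>i. if i = 0 then sin (2 * pi * t) else if i = 1 then cos (2 * pi * t) else 0)"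

lemma sphere_point_eq_iff: "sphere_point s = sphere_point t \<longleftrightarrow> (\<exists>n::int. s = t + n)"
proof -
  have "sphere_point s = sphere_point t \<longleftrightarrow>
      sin (2 * pi * s) = sin (2 * pi * t) \<and> cos (2 * pi * s) = cos (2 * pi * t)"
  proof
    assume "sphere_point s = sphere_point t"
    then have "sphere_point s 0 = sphere_point t 0" "sphere_point s 1 = sphere_point t 1"
      by simp_all
    then show "sin (2 * pi * s) = sin (2 * pi * t) \<and> cos (2 * pi * s) = cos (2 * pi * t)"
      by (simp add: sphere_point_def)
  qed (simp add: sphere_point_def cong: if_cong)
  also have "\<dots> \<longleftrightarrow> (\<exists>n::int. 2 * pi * s = 2 * pi * t + 2 * pi * n)"
    by (rule sin_cos_eq_iff)
  also have "\<dots> \<longleftrightarrow> (\<exists>n::int. 2 * pi * s = 2 * pi * (t + n))"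
    by (simp only: distrib_left)
  also have "\<dots> \<longleftrightarrow> (\<exists>n::int. s = t + n)"
    by (simp only: mult_cancel_left) simp
  finally show ?thesis .
qed

lemma topspace_nsphere_1_alt:
  "topspace (nsphere 1) = {x. (x 0)\<^sup>2 + (x 1)\<^sup>2 = 1 \<and> (\<forall>i>1. x i = 0)}"
  by (simp add: nsphere One_nat_def)

text \<open>A continuous bijection from a compact space to a Hausdorff space is a homeomorphism.
  This transports the known homology of spheres to the circle used here.\<close>

lemma homeomorphic_map_circle: "homeomorphic_map circle (nsphere 1) (loop_map sphere_point)"
proof (rule continuous_imp_homeomorphic_map)
  have sph: "sphere_point t \<in> topspace (nsphere 1)" for t
    by (simp add: topspace_nsphere_1_alt sphere_point_def)
  have loop: "loop_map sphere_point (edge_point (rose 1) 0 t) = sphere_point t" if "t \<in> {0..1}" for t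
  proof (cases "0 < t \<and> t < 1")
    case False
    then have "t = 0 \<or> t = 1" using that by auto
    then show ?thesis by (auto simp: edge_point_circle sphere_point_def)
  qed (simp add: edge_point_circle)
  have cont: "continuous_map (top_of_set {0..1}) (nsphere 1) sphere_point"
  proof -
    have "continuous_on {0..1} (\<lambda>t. sphere_point t i)" for i
      by (cases "i = 0"; cases "i = 1") (auto simp: sphere_point_def intro!: continuous_intros)
    then show ?thesis
      using sph by (auto simp: nsphere continuous_map_in_subtopology continuous_map_componentwise_UNIV)
  qed
  show "continuous_map circle (nsphere 1) (loop_map sphere_point)"
    unfolding continuous_compose_quotient_map_eq[OF quotient_map_circle, symmetric]
    by (rule continuous_map_eq[OF cont]) (auto simp: loop)
  show "compact_space circle"
  proof -
    have "compact_space (top_of_set {0..1::real})"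
      by (simp add: compact_space_subtopology)
    then have "compactin circle (edge_point (rose 1) 0 ` topspace (top_of_set {0..1}))"
      unfolding compact_space_def
      by (rule image_compactin[OF _ quotient_imp_continuous_map[OF quotient_map_circle]])
    then show ?thesis
      unfolding compact_space_def by (simp only: quotient_imp_surjective_map[OF quotient_map_circle])
  qed
  show "Hausdorff_space (nsphere 1)"
    unfolding nsphere by (intro Hausdorff_space_subtopology) (simp add: Hausdorff_space_product_topology)
  show "loop_map sphere_point ` topspace circle = topspace (nsphere 1)"
  proof (intro subset_antisym subsetI)
    fix x assume x: "x \<in> topspace (nsphere 1)"
    then obtain u where u: "0 \<le> u" "u < 2 * pi" "x 1 = cos u" "x 0 = sin u"
      using sincos_total_2pi[of "x 1" "x 0"] by (auto simp: topspace_nsphere_1_alt add.commute)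
    define t where "t = u / (2 * pi)"
    have t: "0 \<le> t" "t < 1" "2 * pi * t = u"
      using u by (auto simp: t_def divide_less_eq)
    have "x = sphere_point t"
      using x by (auto simp: sphere_point_def t u fun_eq_iff topspace_nsphere_1_alt)
    then have "x = loop_map sphere_point (edge_point (rose 1) 0 t)"
      using loop t by auto
    then show "x \<in> loop_map sphere_point ` topspace circle"
      using t points_edge_point[OF wf_digraph_rose, of 0 1 t]
      by (auto simp: topspace_realization wf_digraph_rose arcs_rose)
  next
    fix y assume "y \<in> loop_map sphere_point ` topspace circle"
    then show "y \<in> topspace (nsphere 1)"
      using sph by (auto simp: topspace_realization wf_digraph_rose points_circle)
  qed
  show "inj_on (loop_map sphere_point) (topspace circle)"
    unfolding topspace_realization[OF wf_digraph_rose]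
  proof (rule inj_onI)
    fix x y assume xy: "x \<in> points (rose 1)" "y \<in> points (rose 1)"
      "loop_map sphere_point x = loop_map sphere_point y"
    \<comment> \<open>Parameters of the same point differ by an integer, and both lie in the
      half-open interval from 0 to 1.\<close>
    have *: "s = t" if "sphere_point s = sphere_point t" "0 \<le> s" "s < 1" "0 \<le> t" "t < 1" for s t
    proof -
      obtain n :: int where n: "s = t + n"
        using \<open>sphere_point s = sphere_point t\<close> unfolding sphere_point_eq_iff by blast
      then have "-1 < real_of_int n" "real_of_int n < 1" using that by linarith+
      then have "n = 0" by linarith
      then show ?thesis using n by simp
    qed
    show "x = y"
      using xy(1)
    proof (cases rule: points_circle_cases)
      case x: 1
      show ?thesis
        using xy(2)
      proof (cases rule: points_circle_cases)
        case (2 t)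
        then show ?thesis using xy(3) x *[of 0 t] by simp
      qed (simp add: x)
    next
      case x: (2 s)
      show ?thesis
        using xy(2)
      proof (cases rule: points_circle_cases)
        case 1
        then show ?thesis using xy(3) x *[of s 0] by simp
      next
        case (2 t)
        then show ?thesis using xy(3) x *[of s t] by simp
      qed
    qed
  qed
qed

text \<open>The group is infinite cyclic by comparison with the sphere, so the choice defining
  \<open>circle_class\<close> does pick a generator, and its powers are distinct.\<close>

lemma homology_circle:
  "circle_class \<in> carrier (homology_group 1 circle)"
  "x \<in> carrier (homology_group 1 circle) \<Longrightarrow> \<exists>k::int. x = circle_class [^]\<^bsub>homology_group 1 circle\<^esub> k"
  "circle_class [^]\<^bsub>homology_group 1 circle\<^esub> (j::int) = circle_class [^]\<^bsub>homology_group 1 circle\<^esub> (k::int) \<longleftrightarrow> j = k"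
proof -
  let ?G = "homology_group 1 circle"
  interpret group ?G by simp
  have iso: "?G \<cong> integer_group"
  proof -
    have "?G \<cong> homology_group 1 (nsphere 1)"
      using homeomorphic_map_homology_iso[OF homeomorphic_map_circle] unfolding is_iso_def by blast
    \<comment> \<open>Reduced and ordinary homology agree in degree 1.\<close>
    also have "homology_group 1 (nsphere 1) = reduced_homology_group (int 1) (nsphere 1)"
      by (simp add: un_reduced_homology_group)
    finally show ?thesis
      using reduced_homology_group_nsphere(1)[of 1] iso_trans by blast
  qed
  have "cyclic_group ?G"
    using isomorphic_group_cyclicity[OF iso] by simp
  then have "\<exists>u. u \<in> carrier ?G \<and> subgroup_generated ?G {u} = ?G"
    unfolding cyclic_group_def by blast
  then have u: "circle_class \<in> carrier ?G \<and> subgroup_generated ?G {circle_class} = ?G"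
    unfolding circle_class_def by (rule someI_ex)
  then show "circle_class \<in> carrier ?G" by simp
  show "\<exists>k::int. x = circle_class [^]\<^bsub>?G\<^esub> k" if "x \<in> carrier ?G"
    using that u carrier_subgroup_generated_by_singleton[of circle_class] by auto
  \<comment> \<open>The value 0 of \<open>ord\<close> encodes infinite order.\<close>
  have "ord circle_class = 0"
    using u iso_finite[OF iso] by (simp flip: infinite_cyclic_subgroup_order)
  then show "circle_class [^]\<^bsub>?G\<^esub> j = circle_class [^]\<^bsub>?G\<^esub> k \<longleftrightarrow> j = k"
    using u by (auto simp: int_pow_eq)
qed

section \<open>Winding numbers and reflection of the circle\<close>

text \<open>The coordinate of a class with respect to the generator. At the image of
  \<open>circle_class\<close> under a self-map of the circle it is the degree of that map.\<close>

definition winding :: "(unit, nat) point chain set \<Rightarrow> int" where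
  "winding z = (THE k::int. z = circle_class [^]\<^bsub>homology_group 1 circle\<^esub> k)"

lemma winding_pow [simp]: "winding (circle_class [^]\<^bsub>homology_group 1 circle\<^esub> (k::int)) = k"
  unfolding winding_def by (rule the_equality) (auto simp: homology_circle)

fun circle_reflection :: "(unit, nat) point \<Rightarrow> (unit, nat) point" where
  "circle_reflection (Inl v) = Inl v"
| "circle_reflection (Inr (e, t)) = Inr (e, 1 - t)"

lemma continuous_map_circle_reflection: "continuous_map circle circle circle_reflection"
proof -
  have "continuous_map (top_of_set {0..1}) circle (edge_point (rose 1) 0 \<circ> (\<lambda>t. 1 - t))"
    by (rule continuous_map_compose[of _ "top_of_set {0..1}"])
      (auto intro!: continuous_intros continuous_map_edge_point wf_digraph_rose simp: arcs_rose)
  then have "continuous_map (top_of_set {0..1}) circle (circle_reflection \<circ> edge_point (rose 1) 0)"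
    by (rule continuous_map_eq) (auto simp: edge_point_circle)
  then show ?thesis
    by (simp add: continuous_compose_quotient_map_eq[OF quotient_map_circle])
qed

text \<open>The sign is a square root of \<open>1\<close> because reflections are involutions; its value is never needed.\<close>

lemma winding_circle_reflection:
  obtains s :: int where "s\<^sup>2 = 1" "\<And>z. z \<in> carrier (homology_group 1 circle) \<Longrightarrow>
    winding (hom_induced 1 circle {} circle {} circle_reflection z) = s * winding z"
proof -
  let ?G = "homology_group 1 circle" and ?r = "hom_induced 1 circle {} circle {} circle_reflection"
  interpret group ?G by simp
  interpret r: group_hom ?G ?G ?r
    by unfold_locales (rule hom_induced_empty_hom)
  note u = homology_circle(1)
  obtain s :: int where s: "?r circle_class = circle_class [^]\<^bsub>?G\<^esub> s"
    using homology_circle(2) hom_induced_carrier by blast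
  have pow: "?r (circle_class [^]\<^bsub>?G\<^esub> k) = circle_class [^]\<^bsub>?G\<^esub> (s * k)" for k :: int
    using u by (simp add: r.hom_int_pow s int_pow_pow)
  have "circle_reflection \<circ> circle_reflection = id"
  proof
    fix x show "(circle_reflection \<circ> circle_reflection) x = id x"
      by (cases x rule: circle_reflection.cases) auto
  qed
  then have "?r (?r circle_class) = circle_class"
    using hom_induced_compose_empty[OF continuous_map_circle_reflection continuous_map_circle_reflection, of 1]
      hom_induced_id u by (metis comp_apply)
  then have "circle_class [^]\<^bsub>?G\<^esub> (s * s) = circle_class [^]\<^bsub>?G\<^esub> (1::int)"
    using u by (simp add: s pow)
  then have "s\<^sup>2 = 1"
    by (simp add: homology_circle(3) power2_eq_square)
  moreover have "winding (?r z) = s * winding z" if "z \<in> carrier ?G" for z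
    using homology_circle(2)[OF that] pow by auto
  ultimately show thesis
    by (rule that)
qed

section \<open>Edge coefficients of markings\<close>

lemma points_iff:
  "Inl v \<in> points G \<longleftrightarrow> v \<in> verts G"
  "Inr (e, t) \<in> points G \<longleftrightarrow> e \<in> arcs G \<and> t \<in> {0<..<1}"
  by (auto simp: points_def)

lemma topspace_circle: "topspace circle = insert rose_vertex (Inr ` ({0} \<times> {0<..<1}))"
  by (simp add: topspace_realization wf_digraph_rose points_circle)

text \<open>Along the edge \<open>e\<close> the composite with the parametrization is the
  parametrization of the circle, and along every other edge it is constant.\<close>

lemma continuous_map_collapse:
  assumes "wf_digraph G"
  shows "continuous_map (realization G) circle (collapse e)"
proof (rule continuous_map_from_realization[OF assms])
  show "collapse e \<in> points G \<rightarrow> topspace circle"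
    by (auto simp: topspace_circle points_def)
  fix e' assume "e' \<in> arcs G"
  show "continuous_map (top_of_set {0..1}) circle (\<lambda>t. collapse e (edge_point G e' t))"
  proof (cases "e' = e")
    case True
    then have "collapse e (edge_point G e' t) = edge_point (rose 1) 0 t" for t
      by (simp add: edge_point_def rose_def)
    then show ?thesis
      using quotient_imp_continuous_map[OF quotient_map_circle] by simp
  next
    case False
    then have "collapse e (edge_point G e' t) = rose_vertex" for t
      by (simp add: edge_point_def)
    then show ?thesis
      by (simp add: topspace_circle)
  qed
qed

lemma continuous_map_petal:
  assumes "i < g"
  shows "continuous_map circle (realization (rose g)) (petal i)"
proof -
  have "continuous_map (top_of_set {0..1}) (realization (rose g)) (petal i \<circ> edge_point (rose 1) 0)"
  proof (rule continuous_map_eq)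
    show "continuous_map (top_of_set {0..1}) (realization (rose g)) (edge_point (rose g) i)"
      by (rule continuous_map_edge_point) (simp_all add: wf_digraph_rose arcs_rose assms)
  qed (simp add: edge_point_def rose_def)
  then show ?thesis
    by (simp add: continuous_compose_quotient_map_eq[OF quotient_map_circle])
qed

text \<open>By functoriality the coefficient is the degree of one self-map of the circle.
  Coefficients can then be compared by comparing such maps, pointwise or up to homotopy.\<close>

lemma edge_coefficient_eq_winding:
  assumes "wf_digraph G" "continuous_map (realization (rose g)) (realization G) h" "i < g"
  shows "edge_coefficient G (hom_induced 1 (realization (rose g)) {} (realization G) {} h (petal_class g i)) e =
    winding (hom_induced 1 circle {} circle {} (collapse e \<circ> h \<circ> petal i) circle_class)"
proof -
  note petal = continuous_map_petal[OF assms(3)]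
  have "hom_induced 1 circle {} circle {} (collapse e \<circ> h \<circ> petal i) =
      hom_induced 1 (realization G) {} circle {} (collapse e) \<circ>
        (hom_induced 1 (realization (rose g)) {} (realization G) {} h \<circ>
          hom_induced 1 circle {} (realization (rose g)) {} (petal i))"
    unfolding comp_assoc
      hom_induced_compose_empty[OF continuous_map_compose[OF petal assms(2)] continuous_map_collapse[OF assms(1)]]
      hom_induced_compose_empty[OF petal assms(2)] ..
  then show ?thesis
    unfolding edge_coefficient_def winding_def petal_class_def by simp
qed

section \<open>Invariance under equivalence of markings\<close>

lemma wf_virtual_graph: "wf_digraph (fst \<Gamma>) \<Longrightarrow> wf_digraph (virtual_graph \<Gamma>)"
  by (auto simp: wf_digraph_def virtual_graph_def virtual_loops_def split: prod.splits)

lemma stable_graph_wf: "stable_graph g \<Gamma> \<Longrightarrow> wf_digraph (fst \<Gamma>)"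
  by (auto simp: stable_graph_def fin_digraph_def split: prod.splits)

lemma collapse_virtual_sequence:
  "collapse (Inl e) (virtual_sequence \<Gamma> v is t) = rose_vertex"
  by (induction \<Gamma> v "is" arbitrary: t rule: virtual_sequence.induct) (auto simp: path_concat_def edge_point_def)

text \<open>A homotopy step is absorbed by homotopy invariance of homology; a replacement step
  changes nothing at all once the complement of the edge is collapsed.\<close>

lemma virtual_step_homology:
  assumes "wf_digraph (fst \<Gamma>)" "virtual_step \<Gamma> b p q"
  shows "hom_induced n circle {} circle {} (collapse (Inl e) \<circ> loop_map p) =
    hom_induced n circle {} circle {} (collapse (Inl e) \<circ> loop_map q)"
  using assms(2)
proof cases
  case homotopy
  show ?thesis
    by (rule homology_homotopy_empty, rule homotopic_with_compose_continuous_map_left[OF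
          homotopic_loop_maps[OF homotopy] continuous_map_collapse[OF wf_virtual_graph[OF assms(1)]]]) simp
next
  case (replace v p' q' "is" js)
  \<comment> \<open>Both concatenations use the same parameter intervals: the outer pieces coincide,
    and the middle pieces collapse to the vertex.\<close>
  have "collapse (Inl e) (p t) = collapse (Inl e) (q t)" for t
    by (simp add: replace path_concat_def collapse_virtual_sequence)
  then have "collapse (Inl e) (loop_map p x) = collapse (Inl e) (loop_map q x)" for x
    by (cases "(p, x)" rule: loop_map.cases) auto
  then show ?thesis
    by (intro hom_induced_eq) simp
qed

lemma rtranclp_virtual_step_homology:
  assumes "wf_digraph (fst \<Gamma>)" "(virtual_step \<Gamma> b)\<^sup>*\<^sup>* p q"
  shows "hom_induced n circle {} circle {} (collapse (Inl e) \<circ> loop_map p) =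
    hom_induced n circle {} circle {} (collapse (Inl e) \<circ> loop_map q)"
  using assms(2)
proof induction
  case (step q r)
  then show ?case
    using virtual_step_homology[OF assms(1) step(2), of n e] by metis
qed (rule refl)

text \<open>Links the petals used in homology with the paths used in \<open>virtual_step\<close>.
  Off \<open>points (rose 1)\<close> the two sides may differ, since \<open>edge_point\<close> sends
  parameters outside the unit interval to a vertex.\<close>

lemma petal_eq_loop_map:
  assumes "x \<in> points (rose 1)"
  shows "k (petal i x) = loop_map (marked_loop g k i) x"
  using assms by (cases rule: points_circle_cases) (auto simp: marked_loop_def edge_point_def rose_def)

text \<open>Homology does not see the free homotopies from \<open>h\<close> to \<open>k\<close> and
  from \<open>h'\<close> to \<open>k'\<close>, and the loops of \<open>k\<close> and
  \<open>k'\<close> are joined by virtual steps.\<close>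

lemma marking_equiv_homology:
  assumes "wf_digraph (fst \<Gamma>)" "marking_equiv g \<Gamma> h h'" "i < g"
  shows "hom_induced n circle {} circle {} (collapse (Inl e) \<circ> h \<circ> petal i) =
    hom_induced n circle {} circle {} (collapse (Inl e) \<circ> h' \<circ> petal i)"
proof -
  let ?X = "realization (rose g)" and ?Y = "realization (virtual_graph \<Gamma>)"
  have homotopic: "hom_induced n circle {} circle {} (collapse (Inl e) \<circ> f \<circ> petal i) =
      hom_induced n circle {} circle {} (collapse (Inl e) \<circ> k \<circ> petal i)"
    if "homotopic_with (\<lambda>_. True) ?X ?Y f k" for f k
    by (rule homology_homotopy_empty, rule homotopic_with_compose_continuous_map_right)
      (auto intro!: homotopic_with_compose_continuous_map_left[OF that] continuous_map_petal
        continuous_map_collapse wf_virtual_graph assms)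
  have loop: "hom_induced n circle {} circle {} (collapse (Inl e) \<circ> k \<circ> petal i) =
      hom_induced n circle {} circle {} (collapse (Inl e) \<circ> loop_map (marked_loop g k i))" for k
    by (rule hom_induced_eq) (simp add: topspace_realization wf_digraph_rose petal_eq_loop_map[of _ k i g])
  obtain k k' where h: "homotopic_with (\<lambda>_. True) ?X ?Y h k" "homotopic_with (\<lambda>_. True) ?X ?Y h' k'"
    and steps: "(virtual_step \<Gamma> (k rose_vertex))\<^sup>*\<^sup>* (marked_loop g k i) (marked_loop g k' i)"
    using assms(2,3) unfolding marking_equiv_def by auto
  show ?thesis
    unfolding homotopic[OF h(1)] homotopic[OF h(2)] unfolding loop
    by (rule rtranclp_virtual_step_homology[OF assms(1) steps])
qed

lemma is_marking_continuous:
  "is_marking g \<Gamma> h \<Longrightarrow> continuous_map (realization (rose g)) (realization (virtual_graph \<Gamma>)) h"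
  by (simp add: is_marking_def homotopy_equivalence_def)

text \<open>These are the integers \<open>c_ie\<close>. Only edges tagged \<open>Inl\<close> are
  considered because the quadratic form vanishes on the span of the virtual loops.\<close>

definition marking_coefficient :: "nat \<Rightarrow> ('v, 'e) weighted_graph \<Rightarrow> ('v, 'e) marking \<Rightarrow> nat \<Rightarrow> 'e \<Rightarrow> int" where
  "marking_coefficient g \<Gamma> h i e = edge_coefficient (virtual_graph \<Gamma>)
     (hom_induced 1 (realization (rose g)) {} (realization (virtual_graph \<Gamma>)) {} h (petal_class g i)) (Inl e)"

lemma marking_coefficient_eq_winding:
  assumes "stable_graph g \<Gamma>" "is_marking g \<Gamma> h" "i < g"
  shows "marking_coefficient g \<Gamma> h i e =
    winding (hom_induced 1 circle {} circle {} (collapse (Inl e) \<circ> h \<circ> petal i) circle_class)"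
  unfolding marking_coefficient_def
  using assms by (intro edge_coefficient_eq_winding wf_virtual_graph stable_graph_wf is_marking_continuous)

section \<open>Behaviour under contractions and isomorphisms\<close>

text \<open>Supplies the hypothesis of \<open>collapse_isomorphism_map\<close>, which speaks only
  about points of the contracted graph.\<close>

lemma contraction_map_points:
  assumes "wf_digraph (fst \<Gamma>)" "contraction \<Gamma> S F c \<beta> \<Gamma>'" "x \<in> points (virtual_graph \<Gamma>)"
  shows "contraction_map \<Gamma> S F c \<beta> x \<in> points (virtual_graph \<Gamma>')"
proof -
  obtain G w G' w' where [simp]: "\<Gamma> = (G, w)" "\<Gamma>' = (G', w')"
    by (metis surj_pair)
  have con: "S \<subseteq> arcs G" "F \<subseteq> S" "c ` verts G = verts G'" "arcs G' = arcs G - S"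
    "bij_betw \<beta> (Inl ` (S - F) \<union> virtual_loops (G, w)) (virtual_loops (G', w'))"
    using assms(2) by (auto simp: contraction_def spanning_forest_def)
  have "\<beta> y \<in> virtual_loops (G', w')" if "y \<in> Inl ` (S - F) \<union> virtual_loops (G, w)" for y
    using con(5) that by (auto simp: bij_betw_def)
  moreover have "c (tail G e) \<in> verts G'" if "e \<in> F" for e
  proof -
    have "tail G e \<in> verts G"
      using assms(1) con(1,2) that by (auto simp: wf_digraph_def)
    then show ?thesis
      using con(3) by blast
  qed
  ultimately show ?thesis
    using assms(3) con by (cases x) (auto simp: points_iff virtual_graph_def inj_image_mem_iff)
qed

lemma collapse_contraction_map:
  assumes "contraction \<Gamma> S F c \<beta> \<Gamma>'" "e \<in> arcs (fst \<Gamma>')"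
  shows "collapse (Inl e) (contraction_map \<Gamma> S F c \<beta> x) = collapse (Inl e) x"
proof -
  obtain G w G' w' where [simp]: "\<Gamma> = (G, w)" "\<Gamma>' = (G', w')"
    by (metis surj_pair)
  have con: "F \<subseteq> S" "arcs G' = arcs G - S"
    "bij_betw \<beta> (Inl ` (S - F) \<union> virtual_loops (G, w)) (virtual_loops (G', w'))"
    using assms(1) by (auto simp: contraction_def spanning_forest_def)
  \<comment> \<open>An edge that becomes or remains a virtual loop is different from
    \<open>e\<close> before and after, so its points collapse to the vertex on both sides.\<close>
  have "\<beta> y \<noteq> Inl e \<and> y \<noteq> Inl e" if "y \<in> Inl ` (S - F) \<union> virtual_loops (G, w)" for y
  proof
    have "\<beta> y \<in> virtual_loops (G', w')"
      using con(3) that by (auto simp: bij_betw_def)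
    then show "\<beta> y \<noteq> Inl e"
      by (auto simp: virtual_loops_def)
    show "y \<noteq> Inl e"
      using that con(2) assms(2) by (auto simp: virtual_loops_def)
  qed
  then show ?thesis
    using con assms(2) by (cases x) auto
qed

text \<open>Only the edge \<open>e\<close> is mapped to \<open>e'\<close>, so everything else still
  collapses to the vertex; reversing \<open>e\<close> turns into reflecting the circle.\<close>

lemma collapse_isomorphism_map:
  fixes \<Gamma> \<Gamma>' :: "('v, 'e) weighted_graph"
  assumes "graph_isomorphism \<Gamma> \<Gamma>' a b \<sigma>" "e \<in> arcs (fst \<Gamma>)" "b (Inl e) = Inl e'"
    "x \<in> points (virtual_graph \<Gamma>)"
  shows "collapse (Inl e') (isomorphism_map a b \<sigma> x) =
    (if \<sigma> (Inl e) then circle_reflection else id) (collapse (Inl e) x)"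
proof -
  have b: "inj_on b (Inl ` arcs (fst \<Gamma>))" "b ` virtual_loops \<Gamma> = virtual_loops \<Gamma>'"
    using assms(1) by (auto simp: graph_isomorphism_def bij_betw_def)
  \<comment> \<open>Injectivity on the edges of the graph handles one kind of \<open>y\<close>; a
    virtual loop cannot be mapped to an edge of the graph.\<close>
  have "b y = Inl e' \<longleftrightarrow> y = Inl e" if "y \<in> arcs (virtual_graph \<Gamma>)" for y
  proof -
    have "y \<in> Inl ` arcs (fst \<Gamma>) \<or> y \<in> virtual_loops \<Gamma>"
      using that by (auto simp: virtual_graph_def split: prod.splits)
    moreover have "y \<noteq> Inl e" "b y \<noteq> Inl e'" if "y \<in> virtual_loops \<Gamma>"
    proof -
      have virtual: "z \<noteq> Inl e''" if "z \<in> virtual_loops \<Delta>" for z e'' and \<Delta> :: "('v, 'e) weighted_graph"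
        using that by (auto simp: virtual_loops_def split: prod.splits)
      have "b y \<in> virtual_loops \<Gamma>'"
        using that b(2) by blast
      then show "y \<noteq> Inl e" "b y \<noteq> Inl e'"
        using that virtual by blast+
    qed
    ultimately show ?thesis
      using inj_on_eq_iff[OF b(1), of y "Inl e"] assms(2,3) by auto
  qed
  then show ?thesis
    using assms(4) by (cases x) (auto simp: points_iff split: prod.splits)
qed

text \<open>The sign depends on the edge alone and not on \<open>i\<close>: it records whether the
  isomorphism reverses that edge. Hence the linear form at the edge changes by a common sign, and
  its square stays the same.\<close>

lemma marking_coefficient_specialization:
  assumes \<Gamma>: "stable_graph g \<Gamma>" "is_marking g \<Gamma> h" and \<Gamma>': "stable_graph g \<Gamma>'" "is_marking g \<Gamma>' h'"
    and spec: "marked_specialization g (\<Gamma>, h) (\<Gamma>', h') \<iota>" and e: "e \<in> arcs (fst \<Gamma>')"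
  obtains s :: int where "s\<^sup>2 = 1"
    "\<And>i. i < g \<Longrightarrow> marking_coefficient g \<Gamma>' h' i e = s * marking_coefficient g \<Gamma> h i (\<iota> e)"
proof -
  obtain S F c \<beta> \<Gamma>'' b a \<sigma> where con: "contraction \<Gamma> S F c \<beta> \<Gamma>''"
    and iso: "graph_isomorphism \<Gamma>'' \<Gamma>' a b \<sigma>"
    and equiv: "marking_equiv g \<Gamma>' (isomorphism_map a b \<sigma> \<circ> (contraction_map \<Gamma> S F c \<beta> \<circ> h)) h'"
    and \<iota>: "\<iota> e \<in> arcs (fst \<Gamma>'')" "b (Inl (\<iota> e)) = Inl e"
    using spec e unfolding marked_specialization_def marked_isomorphism_def by auto
  define \<rho> where "\<rho> = (if \<sigma> (Inl (\<iota> e)) then circle_reflection else id)"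
  let ?f = "\<lambda>i. collapse (Inl (\<iota> e)) \<circ> h \<circ> petal i"
  obtain s :: int where s: "s\<^sup>2 = 1"
    "\<And>z. z \<in> carrier (homology_group 1 circle) \<Longrightarrow> winding (hom_induced 1 circle {} circle {} \<rho> z) = s * winding z"
  proof (cases "\<sigma> (Inl (\<iota> e))")
    case True
    obtain s :: int where "s\<^sup>2 = 1" "\<And>z. z \<in> carrier (homology_group 1 circle) \<Longrightarrow>
        winding (hom_induced 1 circle {} circle {} circle_reflection z) = s * winding z"
      by (rule winding_circle_reflection) (rule that)
    then show ?thesis
      using True by (intro that[of s]) (simp_all add: \<rho>_def)
  next
    case False
    then show ?thesis
      using that[of 1] by (simp add: \<rho>_def hom_induced_id)
  qed
  have \<rho>: "continuous_map circle circle \<rho>"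
    by (simp add: \<rho>_def continuous_map_circle_reflection)
  have "marking_coefficient g \<Gamma>' h' i e = s * marking_coefficient g \<Gamma> h i (\<iota> e)" if "i < g" for i
  proof -
    have cont: "continuous_map circle circle (?f i)"
      using that \<Gamma> by (intro continuous_map_compose[OF continuous_map_petal] continuous_map_compose[OF is_marking_continuous]
        continuous_map_collapse wf_virtual_graph stable_graph_wf)
    \<comment> \<open>Collapsing at \<open>e\<close> commutes with the contraction and, up to
      \<rho>, with the isomorphism. Invariance under \<open>marking_equiv\<close> then passes to
      \<open>h'\<close>.\<close>
    have "collapse (Inl e) (isomorphism_map a b \<sigma> (contraction_map \<Gamma> S F c \<beta> (h (petal i x)))) =
        \<rho> (collapse (Inl (\<iota> e)) (h (petal i x)))" if "x \<in> topspace circle" for x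
    proof -
      have "petal i x \<in> topspace (realization (rose g))"
        using continuous_map_petal[OF \<open>i < g\<close>] that by (auto simp: continuous_map_def)
      then have "h (petal i x) \<in> topspace (realization (virtual_graph \<Gamma>))"
        using is_marking_continuous[OF \<Gamma>(2)] by (auto simp: continuous_map_def)
      then have "contraction_map \<Gamma> S F c \<beta> (h (petal i x)) \<in> points (virtual_graph \<Gamma>'')"
        using \<Gamma>(1) con by (simp add: contraction_map_points topspace_realization wf_virtual_graph stable_graph_wf)
      then show ?thesis
        unfolding \<rho>_def
        by (simp add: collapse_isomorphism_map[OF iso \<iota>] collapse_contraction_map[OF con \<iota>(1)])
    qed
    then have "hom_induced 1 circle {} circle {}
          (collapse (Inl e) \<circ> (isomorphism_map a b \<sigma> \<circ> (contraction_map \<Gamma> S F c \<beta> \<circ> h)) \<circ> petal i) =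
        hom_induced 1 circle {} circle {} (\<rho> \<circ> ?f i)"
      by (intro hom_induced_eq) simp
    then have "hom_induced 1 circle {} circle {} (collapse (Inl e) \<circ> h' \<circ> petal i) circle_class =
        hom_induced 1 circle {} circle {} \<rho> (hom_induced 1 circle {} circle {} (?f i) circle_class)"
      using marking_equiv_homology[OF stable_graph_wf[OF \<Gamma>'(1)] equiv that]
      by (simp add: hom_induced_compose_empty[OF cont \<rho>])
    then show ?thesis
      using \<Gamma> \<Gamma>' that by (simp add: marking_coefficient_eq_winding s hom_induced_carrier)
  qed
  with s(1) show thesis
    by (rule that)
qed

section \<open>Rational bases\<close>

definition rational_basis :: "'j set \<Rightarrow> ('j \<Rightarrow> nat \<Rightarrow> real) \<Rightarrow> (nat \<Rightarrow> real) set \<Rightarrow> bool" where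
  "rational_basis J b N \<longleftrightarrow> finite J \<and> (\<forall>j\<in>J. b j \<in> N \<and> (\<forall>i. b j i \<in> \<rat>)) \<and>
     (\<forall>x\<in>N. \<exists>c. \<forall>i. x i = (\<Sum>j\<in>J. c j * b j i)) \<and>
     (\<forall>c. (\<forall>i. (\<Sum>j\<in>J. c j * b j i) = 0) \<longrightarrow> (\<forall>j\<in>J. c j = 0))"

lemma rational_basis_imp_has_rational_basis:
  assumes "rational_basis J b N"
  shows "has_rational_basis N"
proof -
  have J: "finite J" "\<And>j. j \<in> J \<Longrightarrow> b j \<in> N \<and> (\<forall>i. b j i \<in> \<rat>)"
    and span: "\<And>x. x \<in> N \<Longrightarrow> \<exists>c. \<forall>i. x i = (\<Sum>j\<in>J. c j * b j i)"
    and indep: "\<And>c j. (\<And>i. (\<Sum>j\<in>J. c j * b j i) = 0) \<Longrightarrow> j \<in> J \<Longrightarrow> c j = 0"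
    using assms unfolding rational_basis_def by blast+
  obtain \<sigma> where \<sigma>: "bij_betw \<sigma> {..<card J} J"
    using ex_bij_betw_nat_finite[OF J(1)] by (auto simp: atLeast0LessThan)
  have sum: "(\<Sum>j<card J. c j * b (\<sigma> j) i) = (\<Sum>j\<in>J. c (the_inv_into {..<card J} \<sigma> j) * b j i)" for c i
    using sum.reindex_bij_betw[OF \<sigma>, of "\<lambda>j. c (the_inv_into {..<card J} \<sigma> j) * b j i"]
      the_inv_into_f_f[of \<sigma> "{..<card J}"] \<sigma> by (simp add: bij_betw_def)
  have "\<exists>!c. c \<in> {..<card J} \<rightarrow>\<^sub>E UNIV \<and> x = (\<lambda>i. \<Sum>j<card J. c j * b (\<sigma> j) i)" if "x \<in> N" for x
  proof (rule ex_ex1I)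
    obtain c where c: "\<And>i. x i = (\<Sum>j\<in>J. c j * b j i)"
      using span[OF \<open>x \<in> N\<close>] by blast
    have "x i = (\<Sum>j<card J. (\<lambda>j\<in>{..<card J}. c (\<sigma> j)) j * b (\<sigma> j) i)" for i
      using sum.reindex_bij_betw[OF \<sigma>, of "\<lambda>j. c j * b j i"] by (simp add: c)
    then show "\<exists>c. c \<in> {..<card J} \<rightarrow>\<^sub>E UNIV \<and> x = (\<lambda>i. \<Sum>j<card J. c j * b (\<sigma> j) i)"
      by (intro exI[of _ "\<lambda>j\<in>{..<card J}. c (\<sigma> j)"]) auto
  next
    fix c d
    assume c: "c \<in> {..<card J} \<rightarrow>\<^sub>E UNIV \<and> x = (\<lambda>i. \<Sum>j<card J. c j * b (\<sigma> j) i)"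
      and d: "d \<in> {..<card J} \<rightarrow>\<^sub>E UNIV \<and> x = (\<lambda>i. \<Sum>j<card J. d j * b (\<sigma> j) i)"
    \<comment> \<open>Uniqueness follows from independence applied to the difference of the
      coefficients.\<close>
    have "(\<Sum>j<card J. (c j - d j) * b (\<sigma> j) i) = 0" for i
      using c d by (simp add: left_diff_distrib sum_subtractf fun_eq_iff)
    then have "(\<Sum>j\<in>J. (c (the_inv_into {..<card J} \<sigma> j) - d (the_inv_into {..<card J} \<sigma> j)) * b j i) = 0" for i
      using sum[of "\<lambda>j. c j - d j"] by simp
    from indep[OF this] have eq: "c (the_inv_into {..<card J} \<sigma> j) = d (the_inv_into {..<card J} \<sigma> j)" if "j \<in> J" for j
      using that by simp
    have "c j = d j" if "j < card J" for j
      using that eq[of "\<sigma> j"] the_inv_into_f_f[of \<sigma> "{..<card J}" j] bij_betwE[OF \<sigma>] bij_betw_imp_inj_on[OF \<sigma>] by simp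
    then show "c = d"
      using c d by (intro PiE_ext[of c _ _ d]) auto
  qed
  moreover have "\<forall>j<card J. b (\<sigma> j) \<in> N \<and> (\<forall>i. b (\<sigma> j) i \<in> \<rat>)"
    using J(2) \<sigma> by (auto simp: bij_betw_def)
  ultimately show ?thesis
    unfolding has_rational_basis_def by (intro exI[of _ "card J"] exI[of _ "b \<circ> \<sigma>"]) simp
qed

text \<open>One step of Gaussian elimination. A basis vector \<open>b m\<close> with
  \<open>L (b m)\<close> nonzero serves as pivot, and multiples of it are subtracted from the others
  to make \<open>L\<close> vanish. The multipliers are quotients of rational numbers.\<close>

lemma rational_basis_hyperplane:
  fixes J :: "'j set" and g :: nat
  assumes basis: "rational_basis J b N" and r: "\<And>i. r i \<in> \<rat>"
    and N: "\<And>x y t. x \<in> N \<Longrightarrow> y \<in> N \<Longrightarrow> (\<lambda>i. x i - t * y i) \<in> N"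
  obtains J' b' where "rational_basis (J' :: 'j set) b' {x \<in> N. (\<Sum>i<g. x i * r i) = 0}"
proof -
  define L where "L x = (\<Sum>i<g. x i * r i)" for x :: "nat \<Rightarrow> real"
  have J: "finite J" "\<And>j. j \<in> J \<Longrightarrow> b j \<in> N" "\<And>i j. j \<in> J \<Longrightarrow> b j i \<in> \<rat>"
    and span: "\<And>x. x \<in> N \<Longrightarrow> \<exists>c. \<forall>i. x i = (\<Sum>j\<in>J. c j * b j i)"
    and indep: "\<And>c j. (\<And>i. (\<Sum>j\<in>J. c j * b j i) = 0) \<Longrightarrow> j \<in> J \<Longrightarrow> c j = 0"
    using basis unfolding rational_basis_def by blast+
  have L_sum: "L x = (\<Sum>j\<in>J. c j * L (b j))" if "\<And>i. x i = (\<Sum>j\<in>J. c j * b j i)" for x c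
  proof -
    have "L x = (\<Sum>i<g. \<Sum>j\<in>J. c j * (b j i * r i))"
      by (simp add: L_def that sum_distrib_right mult.assoc)
    then show ?thesis
      by (simp add: L_def sum_distrib_left sum.swap[of _ J])
  qed
  have L_diff: "L (\<lambda>i. x i - t * y i) = L x - t * L y" for x y t
    by (simp add: L_def left_diff_distrib sum_subtractf sum_distrib_left mult.assoc)
  show thesis
  proof (cases "\<forall>j\<in>J. L (b j) = 0")
    case True
    have "L x = 0" if "x \<in> N" for x
    proof -
      obtain c where "\<And>i. x i = (\<Sum>j\<in>J. c j * b j i)"
        using span[OF \<open>x \<in> N\<close>] by blast
      from L_sum[OF this] show ?thesis
        using True by simp
    qed
    then have "{x \<in> N. (\<Sum>i<g. x i * r i) = 0} = N"
      by (auto simp: L_def)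
    then show thesis
      using basis by (intro that[of J b]) simp
  next
    case False
    then obtain m where m: "m \<in> J" "L (b m) \<noteq> 0"
      by blast
    define b' where "b' j = (\<lambda>i. b j i - L (b j) / L (b m) * b m i)" for j
    let ?J = "J - {m}"
    \<comment> \<open>Expressing a combination of the new vectors in the old basis forces the
      coefficient at \<open>m\<close>. Spanning and independence of the new family are both read off
      from this.\<close>
    have b'_sum: "(\<Sum>j\<in>?J. d j * b' j i) =
        (\<Sum>j\<in>J. (if j = m then - (\<Sum>j\<in>?J. d j * L (b j)) / L (b m) else d j) * b j i)" for d i
    proof -
      have "(\<Sum>j\<in>?J. d j * b' j i) = (\<Sum>j\<in>?J. d j * b j i) - (\<Sum>j\<in>?J. d j * L (b j)) / L (b m) * b m i"
        by (simp add: b'_def right_diff_distrib sum_subtractf sum_distrib_right sum_divide_distrib mult.assoc)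
      then show ?thesis
        by (simp add: sum.remove[OF J(1) m(1)])
    qed
    have L_rat: "L (b j) \<in> \<rat>" if "j \<in> J" for j
      unfolding L_def using J(3)[OF that] r by (intro Rats_sum Rats_mult)
    have "rational_basis ?J b' {x \<in> N. L x = 0}"
      unfolding rational_basis_def
    proof (intro conjI ballI allI impI)
      fix j assume "j \<in> ?J"
      then have "b' j \<in> N"
        unfolding b'_def using J(2) m by (intro N) auto
      moreover have "L (b' j) = 0"
        unfolding b'_def L_diff using m by simp
      ultimately show "b' j \<in> {x \<in> N. L x = 0}"
        by simp
      show "b' j i \<in> \<rat>" for i
        unfolding b'_def using \<open>j \<in> ?J\<close> m L_rat J(3) by (intro Rats_diff Rats_mult Rats_divide) auto
    next
      fix x assume x: "x \<in> {x \<in> N. L x = 0}"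
      then obtain c where c: "\<And>i. x i = (\<Sum>j\<in>J. c j * b j i)"
        using span by blast
      \<comment> \<open>On the hyperplane the pivot coefficient is determined by the other ones, and
        it is the coefficient found in \<open>b'_sum\<close>.\<close>
      have "(\<Sum>j\<in>J. c j * L (b j)) = 0"
        using L_sum[OF c] x by simp
      then have "c m * L (b m) = - (\<Sum>j\<in>?J. c j * L (b j))"
        by (simp add: sum.remove[OF J(1) m(1)])
      then have "c m = - (\<Sum>j\<in>?J. c j * L (b j)) / L (b m)"
        using m(2) by (metis nonzero_mult_div_cancel_right)
      then have "x i = (\<Sum>j\<in>?J. c j * b' j i)" for i
        unfolding b'_sum c by (intro sum.cong) auto
      then show "\<exists>c. \<forall>i. x i = (\<Sum>j\<in>?J. c j * b' j i)"
        by blast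
    next
      fix d j assume d: "\<forall>i. (\<Sum>j\<in>?J. d j * b' j i) = 0" and j: "j \<in> ?J"
      then show "d j = 0"
        using indep[of "\<lambda>j. if j = m then - (\<Sum>j\<in>?J. d j * L (b j)) / L (b m) else d j" j]
        unfolding b'_sum by simp
    qed (use J in auto)
    then show thesis
      unfolding L_def by (rule that)
  qed
qed

lemma real_space_iff: "x \<in> real_space g \<longleftrightarrow> (\<forall>i\<ge>g. x i = 0)"
  by (simp add: topspace_Euclidean_space)

text \<open>Induction on the set of equations, starting from the standard basis and eliminating once
  for each equation.\<close>

lemma has_rational_basis_kernel:
  assumes "finite E" "\<And>i e. a i e \<in> \<rat>"
  shows "has_rational_basis {x \<in> real_space g. \<forall>e\<in>E. (\<Sum>i<g. x i * a i e) = 0}"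
proof -
  let ?N = "\<lambda>E. {x \<in> real_space g. \<forall>e\<in>E. (\<Sum>i<g. x i * a i e) = 0}"
  have "\<exists>J b. rational_basis (J :: nat set) b (?N E)"
    using assms(1)
  proof induction
    case empty
    have sum: "(\<Sum>j<g. c j * unit_vec j i) = (if i < g then c i else 0)" for c i
      by (simp add: unit_vec_def if_distrib[of "\<lambda>x. _ * x"] cong: if_cong)
    have "rational_basis {..<g} unit_vec (real_space g)"
      unfolding rational_basis_def sum
    proof (intro conjI ballI)
      fix x :: "nat \<Rightarrow> real" assume "x \<in> real_space g"
      then show "\<exists>c. \<forall>i. x i = (if i < g then c i else 0)"
        by (intro exI[of _ x]) (auto simp: real_space_iff not_less)
    qed (auto simp: unit_vec_def real_space_iff)
    then show ?case
      by (intro exI) simp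
  next
    case (insert e E)
    then obtain J :: "nat set" and b where basis: "rational_basis J b (?N E)"
      by blast
    have "(\<lambda>i. x i - t * y i) \<in> ?N E" if "x \<in> ?N E" "y \<in> ?N E" for x y t
    proof -
      have "(\<Sum>i<g. (x i - t * y i) * a i e) = (\<Sum>i<g. x i * a i e) - t * (\<Sum>i<g. y i * a i e)" for e
        by (simp add: left_diff_distrib sum_subtractf sum_distrib_left mult.assoc)
      then show ?thesis
        using that by (simp add: real_space_iff)
    qed
    then obtain J' :: "nat set" and b' where
      "rational_basis J' b' {x \<in> ?N E. (\<Sum>i<g. x i * a i e) = 0}"
      using assms(2) by (rule_tac rational_basis_hyperplane[OF basis, of "\<lambda>i. a i e" g])
    moreover have "{x \<in> ?N E. (\<Sum>i<g. x i * a i e) = 0} = ?N (insert e E)"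
      by auto
    ultimately show ?case
      by auto
  qed
  then show ?thesis
    using rational_basis_imp_has_rational_basis by blast
qed

section \<open>Weighted sums of squares of integral linear forms\<close>

definition square_sum_form :: "nat \<Rightarrow> 'e set \<Rightarrow> (nat \<Rightarrow> 'e \<Rightarrow> int) \<Rightarrow> ('e \<Rightarrow> real) \<Rightarrow> (nat \<Rightarrow> real) \<Rightarrow> real" where
  "square_sum_form g E a l = (\<lambda>x\<in>real_space g. \<Sum>e\<in>E. (\<Sum>i<g. x i * of_int (a i e))\<^sup>2 * l e)"

text \<open>Separates topology from linear algebra: the marking enters the form only through an
  integer matrix.\<close>

lemma pullback_form_eq_square_sum_form:
  "pullback_form g \<Gamma> h = square_sum_form g (arcs (fst \<Gamma>)) (marking_coefficient g \<Gamma> h)"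
  by (simp add: pullback_form_def square_sum_form_def curve_form_def phi_def marking_coefficient_def
      Let_def fun_eq_iff)

text \<open>Polarization of each square, using that the linear forms are additive.\<close>

lemma polar_form_square_sum_form:
  assumes "x \<in> real_space g" "y \<in> real_space g"
  shows "polar_form (square_sum_form g E a l) x y =
    (\<Sum>e\<in>E. (\<Sum>i<g. x i * of_int (a i e)) * (\<Sum>i<g. y i * of_int (a i e)) * l e)"
proof -
  let ?\<alpha> = "\<lambda>x e. \<Sum>i<g. x i * of_int (a i e) :: real"
  \<comment> \<open>The form is \<open>undefined\<close> outside \<open>real_space g\<close>, so it
    can be evaluated at the sum only after this check.\<close>
  have xy: "(\<lambda>i. x i + y i) \<in> real_space g"
    using assms by (simp add: real_space_iff)
  have add: "?\<alpha> (\<lambda>i. x i + y i) e = ?\<alpha> x e + ?\<alpha> y e" for e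
    by (simp add: distrib_right sum.distrib)
  have "(\<Sum>e\<in>E. (?\<alpha> x e + ?\<alpha> y e)\<^sup>2 * l e) - (\<Sum>e\<in>E. (?\<alpha> x e)\<^sup>2 * l e) - (\<Sum>e\<in>E. (?\<alpha> y e)\<^sup>2 * l e) =
      (\<Sum>e\<in>E. (?\<alpha> x e + ?\<alpha> y e)\<^sup>2 * l e - (?\<alpha> x e)\<^sup>2 * l e - (?\<alpha> y e)\<^sup>2 * l e)"
    by (simp add: sum_subtractf)
  also have "\<dots> = (\<Sum>e\<in>E. 2 * (?\<alpha> x e * ?\<alpha> y e * l e))"
    by (intro sum.cong refl) (simp add: power2_eq_square algebra_simps)
  also have "\<dots> = 2 * (\<Sum>e\<in>E. ?\<alpha> x e * ?\<alpha> y e * l e)"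
    by (simp only: sum_distrib_left)
  finally show ?thesis
    unfolding polar_form_def square_sum_form_def using assms xy by (simp add: add)
qed

lemma square_sum_form_rational_psd:
  assumes "finite E" "\<And>e. e \<in> E \<Longrightarrow> 0 \<le> l e"
  shows "square_sum_form g E a l \<in> rational_psd_forms g"
proof -
  let ?q = "square_sum_form g E a l"
  let ?\<alpha> = "\<lambda>x e. \<Sum>i<g. x i * of_int (a i e) :: real"
  have "?q x = (\<Sum>i<g. \<Sum>j<g. (\<Sum>e\<in>E. of_int (a i e * a j e) * l e) * x i * x j)" if "x \<in> real_space g" for x
  proof -
    have "?q x = (\<Sum>e\<in>E. \<Sum>i<g. \<Sum>j<g. of_int (a i e * a j e) * l e * x i * x j)"
      unfolding square_sum_form_def restrict_apply'[OF that] power2_eq_square sum_product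
      unfolding sum_distrib_right by (simp add: mult_ac)
    also have "\<dots> = (\<Sum>i<g. \<Sum>e\<in>E. \<Sum>j<g. of_int (a i e * a j e) * l e * x i * x j)"
      by (rule sum.swap)
    also have "\<dots> = (\<Sum>i<g. \<Sum>j<g. \<Sum>e\<in>E. of_int (a i e * a j e) * l e * x i * x j)"
      by (intro sum.cong refl sum.swap)
    finally show ?thesis
      by (simp add: sum_distrib_right)
  qed
  then have quadratic: "quadratic_form g ?q"
    unfolding quadratic_form_def
    by (intro conjI exI[of _ "\<lambda>i j. \<Sum>e\<in>E. of_int (a i e * a j e) * l e"])
      (auto simp: square_sum_form_def mult_ac)
  have nonneg: "0 \<le> ?q x" if "x \<in> real_space g" for x
    using that assms by (simp add: square_sum_form_def sum_nonneg)
  \<comment> \<open>Edges of length 0, which occur on the boundary of a cone, impose no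
    condition.\<close>
  have "null_space g ?q = {x \<in> real_space g. \<forall>e\<in>{e \<in> E. 0 < l e}. ?\<alpha> x e = 0}"
  proof (intro subset_antisym subsetI)
    fix x assume "x \<in> null_space g ?q"
    \<comment> \<open>Pairing \<open>x\<close> with itself gives a vanishing sum of nonnegative
      terms, hence every term vanishes.\<close>
    then have x: "x \<in> real_space g" "polar_form ?q x x = 0"
      by (auto simp: null_space_def)
    then have "(\<Sum>e\<in>E. ?\<alpha> x e * ?\<alpha> x e * l e) = 0"
      by (simp add: polar_form_square_sum_form)
    then have "\<forall>e\<in>E. ?\<alpha> x e * ?\<alpha> x e * l e = 0"
      using assms by (subst (asm) sum_nonneg_eq_0_iff) auto
    then show "x \<in> {x \<in> real_space g. \<forall>e\<in>{e \<in> E. 0 < l e}. ?\<alpha> x e = 0}"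
      using x by auto
  next
    fix x assume x: "x \<in> {x \<in> real_space g. \<forall>e\<in>{e \<in> E. 0 < l e}. ?\<alpha> x e = 0}"
    have "?\<alpha> x e * ?\<alpha> y e * l e = 0" if "e \<in> E" for e y
      using x that assms(2)[OF that] by (cases "l e = 0") auto
    then have "(\<Sum>e\<in>E. ?\<alpha> x e * ?\<alpha> y e * l e) = 0" for y
      by (intro sum.neutral ballI)
    then show "x \<in> null_space g ?q"
      using x by (simp add: null_space_def polar_form_square_sum_form)
  qed
  then have "has_rational_basis (null_space g ?q)"
    using assms(1) by (simp only:) (rule has_rational_basis_kernel, auto)
  then show ?thesis
    using quadratic nonneg by (simp add: rational_psd_forms_def)
qed

text \<open>Pairing with unit vectors extracts the coefficients. Each entry is linear in
  \<open>l\<close>, which is the source of continuity.\<close>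

lemma gram_matrix_square_sum_form:
  "gram_matrix g (square_sum_form g E a l) =
    (\<lambda>(i, j)\<in>{(i, j). i \<le> j \<and> j < g}. \<Sum>e\<in>E. of_int (a i e) * of_int (a j e) * l e)"
proof -
  have "(\<Sum>k<g. unit_vec i k * of_int (a k e)) = of_int (a i e)" if "i < g" for i e
    using that by (simp add: unit_vec_def if_distrib[of "\<lambda>x. x * _"] cong: if_cong)
  moreover have "unit_vec i \<in> real_space g" if "i < g" for i
    using that by (auto simp: unit_vec_def real_space_iff)
  ultimately show ?thesis
    unfolding gram_matrix_def by (intro restrict_ext) (auto simp: polar_form_square_sum_form)
qed

text \<open>The topology of \<open>Omega_rt g\<close> is pulled back along
  \<open>gram_matrix\<close>, so it suffices that the matrix entries are continuous in
  \<open>l\<close> and that the values are rational semi-definite forms.\<close>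

lemma continuous_map_square_sum_form:
  assumes "finite E"
  shows "continuous_map (product_topology (\<lambda>_. top_of_set {0..}) E) (Omega_rt g) (square_sum_form g E a)"
  unfolding Omega_rt_def
proof (rule continuous_map_pullback')
  let ?T = "product_topology (\<lambda>_. top_of_set {0..}) E :: ('a \<Rightarrow> real) topology"
  have "continuous_map ?T euclideanreal (\<lambda>l. l e)" if "e \<in> E" for e
    using continuous_map_product_projection[OF that, of "\<lambda>_. top_of_set {0..}"]
    by (rule continuous_map_into_fulltopology)
  then have "continuous_map ?T euclideanreal (\<lambda>l. \<Sum>e\<in>E. of_int (a i e) * of_int (a j e) * l e)" for i j
    using assms by (intro continuous_map_sum continuous_map_real_mult) auto
  then show "continuous_map ?T (product_topology (\<lambda>_. euclideanreal) {(i, j). i \<le> j \<and> j < g})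
      (gram_matrix g \<circ> square_sum_form g E a)"
    by (auto simp: continuous_map_componentwise gram_matrix_square_sum_form)
  show "topspace ?T \<subseteq> square_sum_form g E a -` rational_psd_forms g"
    using square_sum_form_rational_psd[OF assms] by (auto simp: PiE_iff)
qed

section \<open>The quotient space\<close>

lemma generated_equiv_minimal: "equiv A R \<Longrightarrow> r \<subseteq> R \<Longrightarrow> generated_equiv A r \<subseteq> R"
  by (auto simp: generated_equiv_def)

lemma refl_generated_equiv: "x \<in> A \<Longrightarrow> (x, x) \<in> generated_equiv A r"
  by (auto simp: generated_equiv_def dest: equivE refl_onD)

lemma topspace_quotient_space: "topspace (quotient_space X R) = topspace X // R"
proof
  have "{x \<in> topspace X. R `` {x} \<in> topspace X // R} = topspace X"
    by (auto intro: quotientI)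
  then have "openin (quotient_space X R) (topspace X // R)"
    by (simp add: openin_quotient_space)
  then show "topspace X // R \<subseteq> topspace (quotient_space X R)"
    by (rule openin_subset)
  show "topspace (quotient_space X R) \<subseteq> topspace X // R"
    using openin_quotient_space[of X R] by (metis openin_topspace)
qed

lemma continuous_map_from_quotient_space:
  assumes "continuous_map X Y (\<lambda>x. f (R `` {x}))"
  shows "continuous_map (quotient_space X R) Y f"
  unfolding continuous_map_def topspace_quotient_space
proof (intro conjI allI impI)
  show "f \<in> topspace X // R \<rightarrow> topspace Y"
    using assms by (auto simp: continuous_map_def elim!: quotientE)
  fix U assume "openin Y U"
  then have "openin X {x \<in> topspace X. f (R `` {x}) \<in> U}"
    by (rule openin_continuous_map_preimage[OF assms])
  moreover have "{x \<in> topspace X. R `` {x} \<in> {p \<in> topspace X // R. f p \<in> U}} =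
      {x \<in> topspace X. f (R `` {x}) \<in> U}"
    by (auto intro: quotientI)
  ultimately show "openin (quotient_space X R) {p \<in> topspace X // R. f p \<in> U}"
    by (auto simp: openin_quotient_space)
qed

lemma continuous_map_from_sum_topology:
  assumes "\<And>i. i \<in> I \<Longrightarrow> continuous_map (X i) Y (\<lambda>x. f (i, x))"
  shows "continuous_map (sum_topology X I) Y f"
  unfolding continuous_map_def topspace_sum_topology
proof (intro conjI allI impI)
  show "f \<in> Sigma I (topspace \<circ> X) \<rightarrow> topspace Y"
    using continuous_map_funspace[OF assms] by fastforce
  fix U assume U: "openin Y U"
  have "openin (X i) {x. (i, x) \<in> {p \<in> Sigma I (topspace \<circ> X). f p \<in> U}}" if "i \<in> I" for i
    using openin_continuous_map_preimage[OF assms[OF that] U] that by simp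
  then show "openin (sum_topology X I) {p \<in> Sigma I (topspace \<circ> X). f p \<in> U}"
    by (auto simp: openin_sum_topology)
qed

section \<open>The period map on the quotient of the cones\<close>

lemma finite_arcs_marked_graph: "((G, w), h) \<in> marked_graphs g \<Longrightarrow> finite (arcs G)"
  by (auto simp: marked_graphs_def stable_graph_def fin_digraph_def fin_digraph_axioms_def)

text \<open>The edge bijection \<open>b\<close> undoes \<iota>, which makes \<iota> injective; the
  edges surviving a contraction are edges of the original graph.\<close>

lemma marked_specialization_edges:
  assumes "marked_specialization g m m' \<iota>"
  shows "inj_on \<iota> (arcs (fst (fst m')))" "\<iota> ` arcs (fst (fst m')) \<subseteq> arcs (fst (fst m))"
proof -
  obtain \<Gamma> h \<Gamma>' h' where m: "m = (\<Gamma>, h)" "m' = (\<Gamma>', h')"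
    by (metis surj_pair)
  obtain S F c \<beta> \<Gamma>'' b where con: "contraction \<Gamma> S F c \<beta> \<Gamma>''"
    and "marked_isomorphism g (\<Gamma>'', contraction_map \<Gamma> S F c \<beta> \<circ> h) (\<Gamma>', h') b"
    and \<iota>: "\<forall>e\<in>arcs (fst \<Gamma>'). \<iota> e \<in> arcs (fst \<Gamma>'') \<and> b (Inl (\<iota> e)) = Inl e"
    using assms unfolding marked_specialization_def m prod.case by blast
  show "inj_on \<iota> (arcs (fst (fst m')))"
    using \<iota> m by (intro inj_onI) (metis fst_conv sum.inject(1))
  have "arcs (fst \<Gamma>'') \<subseteq> arcs (fst \<Gamma>)"
    using con by (auto simp: contraction_def split: prod.splits)
  then show "\<iota> ` arcs (fst (fst m')) \<subseteq> arcs (fst (fst m))"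
    using \<iota> m by auto
qed

lemma pullback_form_cone_inclusion:
  assumes "(\<Gamma>, h) \<in> marked_graphs g" "(\<Gamma>', h') \<in> marked_graphs g"
    and spec: "marked_specialization g (\<Gamma>, h) (\<Gamma>', h') \<iota>"
  shows "pullback_form g \<Gamma> h (cone_inclusion (\<Gamma>, h) (\<Gamma>', h') \<iota> l') = pullback_form g \<Gamma>' h' l'"
proof -
  let ?E = "arcs (fst \<Gamma>)" and ?E' = "arcs (fst \<Gamma>')"
  let ?c = "marking_coefficient g \<Gamma> h" and ?c' = "marking_coefficient g \<Gamma>' h'"
  note inj = marked_specialization_edges(1)[OF spec, simplified]
    and sub = marked_specialization_edges(2)[OF spec, simplified]
  have fin: "finite ?E"
    using assms(1) finite_arcs_marked_graph by (metis prod.collapse)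
  have "(\<Sum>e\<in>?E. (\<Sum>i<g. x i * of_int (?c i e))\<^sup>2 * cone_inclusion (\<Gamma>, h) (\<Gamma>', h') \<iota> l' e) =
      (\<Sum>e\<in>?E'. (\<Sum>i<g. x i * of_int (?c' i e))\<^sup>2 * l' e)" for x :: "nat \<Rightarrow> real"
  proof -
    \<comment> \<open>Off the image of \<iota> the extended length function is 0, so these edges
      contribute nothing.\<close>
    have "(\<Sum>e\<in>?E. (\<Sum>i<g. x i * of_int (?c i e))\<^sup>2 * cone_inclusion (\<Gamma>, h) (\<Gamma>', h') \<iota> l' e) =
        (\<Sum>e\<in>\<iota> ` ?E'. (\<Sum>i<g. x i * of_int (?c i e))\<^sup>2 * l' (the_inv_into ?E' \<iota> e))"
      using sub by (intro sum.mono_neutral_cong_right fin) (auto simp: cone_inclusion_def Let_def)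
    also have "\<dots> = (\<Sum>e\<in>?E'. (\<Sum>i<g. x i * of_int (?c i (\<iota> e)))\<^sup>2 * l' e)"
      by (simp add: sum.reindex[OF inj] the_inv_into_f_f[OF inj])
    also have "\<dots> = (\<Sum>e\<in>?E'. (\<Sum>i<g. x i * of_int (?c' i e))\<^sup>2 * l' e)"
    proof (rule sum.cong[OF refl])
      fix e assume "e \<in> ?E'"
      then obtain s :: int where s: "s\<^sup>2 = 1" "\<And>i. i < g \<Longrightarrow> ?c' i e = s * ?c i (\<iota> e)"
        using assms by (auto simp: marked_graphs_def elim: marking_coefficient_specialization[OF _ _ _ _ spec])
      \<comment> \<open>The sign is the same for all \<open>i\<close>, so it factors out and
        disappears on squaring.\<close>
      have "(\<Sum>i<g. x i * of_int (?c' i e)) = of_int s * (\<Sum>i<g. x i * of_int (?c i (\<iota> e)))"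
        by (simp add: s(2) sum_distrib_left mult_ac)
      moreover have "(of_int s :: real)\<^sup>2 = 1"
        using s(1) by (metis of_int_1 of_int_power)
      ultimately show "(\<Sum>i<g. x i * of_int (?c i (\<iota> e)))\<^sup>2 * l' e = (\<Sum>i<g. x i * of_int (?c' i e))\<^sup>2 * l' e"
        by (simp add: power_mult_distrib)
    qed
    finally show ?thesis .
  qed
  then show ?thesis
    by (simp add: pullback_form_eq_square_sum_form square_sum_form_def)
qed

lemma cone_inclusion_in_cone:
  assumes "l' \<in> topspace (cone m')" "inj_on \<iota> (arcs (fst (fst m')))"
  shows "cone_inclusion m m' \<iota> l' \<in> topspace (cone m)"
  using assms the_inv_into_f_f[OF assms(2)] by (auto simp: cone_def cone_inclusion_def Let_def PiE_iff)

lemma topspace_cone_coproduct: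
  "topspace (cone_coproduct g) = {(m, l). m \<in> marked_graphs g \<and> l \<in> topspace (cone m)}"
  by (auto simp: cone_coproduct_def)

text \<open>Having the same pulled back form is an equivalence relation that contains all gluings,
  hence it contains the relation they generate.\<close>

lemma teich_equiv_pullback_form:
  assumes "(((\<Gamma>, h), l), ((\<Gamma>', h'), l')) \<in> teich_equiv g"
  shows "pullback_form g \<Gamma> h l = pullback_form g \<Gamma>' h' l'"
proof -
  let ?A = "topspace (cone_coproduct g)" and ?F = "\<lambda>((\<Gamma>, h), l). pullback_form g \<Gamma> h l"
  let ?R = "{(p, q). p \<in> ?A \<and> q \<in> ?A \<and> ?F p = ?F q}"
  have "equiv ?A ?R"
    by (rule equivI) (auto simp: refl_on_def sym_def trans_def)
  moreover have "cone_gluing g \<subseteq> ?R"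
    by (auto simp: cone_gluing_def topspace_cone_coproduct pullback_form_cone_inclusion
        intro: cone_inclusion_in_cone marked_specialization_edges)
  ultimately have "teich_equiv g \<subseteq> ?R"
    unfolding teich_equiv_def by (rule generated_equiv_minimal)
  then show ?thesis
    using assms by auto
qed

text \<open>The class contains its own representative and all its members give one form, so
  \<open>the_elem\<close> is applied to a singleton.\<close>

lemma tropical_period_map_teich_point:
  assumes "((\<Gamma>, h), l) \<in> topspace (cone_coproduct g)"
  shows "tropical_period_map g (teich_point g (\<Gamma>, h) l) = pullback_form g \<Gamma> h l"
proof -
  have "((\<Gamma>, h), l) \<in> teich_point g (\<Gamma>, h) l"
    using assms by (simp add: teich_point_def teich_equiv_def refl_generated_equiv)
  moreover have "pullback_form g \<Gamma>' h' l' = pullback_form g \<Gamma> h l"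
    if "((\<Gamma>', h'), l') \<in> teich_point g (\<Gamma>, h) l" for \<Gamma>' h' l'
    using that teich_equiv_pullback_form[of \<Gamma> h l \<Gamma>' h' l' g] by (simp add: teich_point_def)
  ultimately have "(\<lambda>((\<Gamma>, h), l). pullback_form g \<Gamma> h l) ` teich_point g (\<Gamma>, h) l = {pullback_form g \<Gamma> h l}"
    by (force intro: image_eqI[of _ _ "((\<Gamma>, h), l)"])
  then show ?thesis
    by (simp add: tropical_period_map_def)
qed

theorem mainTheorem2:
  fixes g :: nat
  shows "(\<forall>\<Gamma> h l. tropical_curve g \<Gamma> l \<and> is_marking g \<Gamma> h \<longrightarrow>
            tropical_period_map g (teich_point g (\<Gamma>, h) l) = pullback_form g \<Gamma> h l) \<and>
         continuous_map (tropical_teichmueller_space g) (Omega_rt g) (tropical_period_map g)"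
proof (intro conjI allI impI)
  fix \<Gamma> :: "(nat, nat) weighted_graph" and h l
  assume "tropical_curve g \<Gamma> l \<and> is_marking g \<Gamma> h"
  \<comment> \<open>Positive lengths are nonnegative, so a tropical curve is a point of its closed
    cone.\<close>
  then have "((\<Gamma>, h), l) \<in> topspace (cone_coproduct g)"
    by (auto simp: topspace_cone_coproduct marked_graphs_def tropical_curve_def cone_def PiE_iff less_imp_le
        split: prod.splits)
  then show "tropical_period_map g (teich_point g (\<Gamma>, h) l) = pullback_form g \<Gamma> h l"
    by (rule tropical_period_map_teich_point)
next
  \<comment> \<open>By the universal properties of the quotient and of the coproduct, continuity may
    be checked on each cone separately.\<close>
  have "continuous_map (cone m) (Omega_rt g) (\<lambda>l. tropical_period_map g (teich_equiv g `` {(m, l)}))"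
    if m: "m \<in> marked_graphs g" for m
  proof -
    obtain G w h where [simp]: "m = ((G, w), h)"
      by (metis surj_pair)
    have "continuous_map (cone m) (Omega_rt g) (pullback_form g (G, w) h)"
      unfolding pullback_form_eq_square_sum_form cone_def
      using continuous_map_square_sum_form[OF finite_arcs_marked_graph] m by simp
    then show ?thesis
    proof (rule continuous_map_eq)
      fix l assume "l \<in> topspace (cone m)"
      then show "pullback_form g (G, w) h l = tropical_period_map g (teich_equiv g `` {(m, l)})"
        using tropical_period_map_teich_point[of "(G, w)" h l g] m
        by (simp add: topspace_cone_coproduct teich_point_def)
    qed
  qed
  then show "continuous_map (tropical_teichmueller_space g) (Omega_rt g) (tropical_period_map g)"
    unfolding tropical_teichmueller_space_def cone_coproduct_def
    by (intro continuous_map_from_quotient_space continuous_map_from_sum_topology)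
qed

end
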